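(* Let $(l_1,\dots,l_m)$ be the (non-increasing) segment sequence of some unicyclic graph with $l_1\leq 2$, and let $H\in\mathbb{U}(l_1,\dots,l_m)$. (i) If $l_1=2$ and $m\geq 4$, then $\sigma(H)\leq \sigma(U_{l_1,l_2}(l_4,\dots,l_m;l_3))$. (ii) If $l_1=1$ and $m\geq 6$, then $\sigma(H)\leq\sigma(U^1_m)$.
   Context: A unicyclic graph is a connected graph containing exactly one cycle. A segment of a graph $G$ is a path whose end vertices each have degree $1$ or at least $3$ in $G$ and whose internal vertices all have degree $2$ in $G$; its length is its number of edges; the segment sequence of $G$ is the non-increasing sequence of its segment lengths; $\mathbb{U}(l_1,\dots,l_m)$ is the set of unicyclic graphs with segment sequence $(l_1,\dots,l_m)$. A pendent path of length $\ell$ attached at $w$ consists of $\ell$ new vertices $x_1,\dots,x_\ell$ and edges $wx_1,\dots,x_{\ell-1}x_\ell$. For positive integers $a,b$ and nonempty lists $s_1,\dots,s_t$ and $r_1,\dots,r_q$, $U_{a,b}(s_1,\dots,s_t;r_1,\dots,r_q)$ is obtained from the cycle $C_{a+b}$ by choosing two vertices $x,y$ splitting the cycle into paths of lengths $a$ and $b$, attaching pendent paths of lengths $s_1,\dots,s_t$ at $x$ and of lengths $r_1,\dots,r_q$ at $y$. $U^1_n$ is obtained from the triangle $C_3$ by attaching one pendent vertex to each of two of its vertices and $n-5$ pendent vertices to the third vertex. $\sigma(G)$ is the number of independent vertex subsets of $G$, including the empty set.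
   Formalization: A segment may have coinciding end vertices, so a cycle with exactly one vertex of degree at least 3 counts as a segment; read with proper paths only, the claim fails, e.g. for a triangle with six pendent vertices at one vertex (193 > 20). *)

theory Defs
  imports Main "HOL-Library.Multiset"
begin

definition simple_graph :: "'a set \<Rightarrow> 'a set set \<Rightarrow> bool" where
  "simple_graph V E \<longleftrightarrow> finite V \<and> (\<forall>e\<in>E. \<exists>u v. e = {u, v} \<and> u \<noteq> v \<and> u \<in> V \<and> v \<in> V)"

definition adj :: "'a set set \<Rightarrow> 'a \<Rightarrow> 'a \<Rightarrow> bool" where
  "adj E u v \<longleftrightarrow> {u, v} \<in> E"

definition degree :: "'a set set \<Rightarrow> 'a \<Rightarrow> nat" where
  "degree E u = card {v. {u, v} \<in> E}"

definition connected_graph :: "'a set \<Rightarrow> 'a set set \<Rightarrow> bool" where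
  "connected_graph V E \<longleftrightarrow> (\<forall>u\<in>V. \<forall>v\<in>V. (adj E)\<^sup>*\<^sup>* u v)"

definition is_walk :: "'a set set \<Rightarrow> 'a list \<Rightarrow> bool" where
  "is_walk E ws \<longleftrightarrow> (\<forall>i. Suc i < length ws \<longrightarrow> adj E (ws ! i) (ws ! Suc i))"

definition walk_edges :: "'a list \<Rightarrow> 'a set list" where
  "walk_edges ws = map (\<lambda>i. {ws ! i, ws ! Suc i}) [0..<length ws - 1]"

definition is_cycle_list :: "'a set \<Rightarrow> 'a set set \<Rightarrow> 'a list \<Rightarrow> bool" where
  "is_cycle_list V E vs \<longleftrightarrow> length vs \<ge> 3 \<and> distinct vs \<and> set vs \<subseteq> V \<and>
     is_walk E vs \<and> adj E (last vs) (hd vs)"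

definition cycle_edges :: "'a list \<Rightarrow> 'a set set" where
  "cycle_edges vs = set (walk_edges (vs @ [hd vs]))"

definition cycles :: "'a set \<Rightarrow> 'a set set \<Rightarrow> 'a set set set" where
  "cycles V E = {cycle_edges vs | vs. is_cycle_list V E vs}"

definition unicyclic :: "'a set \<Rightarrow> 'a set set \<Rightarrow> bool" where
  "unicyclic V E \<longleftrightarrow> simple_graph V E \<and> connected_graph V E \<and> card (cycles V E) = 1"

text \<open>Segments: walks v0,...,vk (k \<ge> 1) whose end vertices have degree \<noteq> 2
(i.e. degree 1 or \<ge> 3 in a connected graph), whose internal vertices have degree 2,
are pairwise distinct and distinct from the end vertices, and which use no edge twice.
The two end vertices may coincide (a cycle hanging at a single vertex of degree \<ge> 3).
A segment is identified with its edge set (so a walk and its reverse give the same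
segment); its length is its number of edges.\<close>

definition is_segment :: "'a set \<Rightarrow> 'a set set \<Rightarrow> 'a list \<Rightarrow> bool" where
  "is_segment V E ws \<longleftrightarrow> length ws \<ge> 2 \<and> set ws \<subseteq> V \<and> is_walk E ws \<and>
     distinct (walk_edges ws) \<and>
     degree E (hd ws) \<noteq> 2 \<and> degree E (last ws) \<noteq> 2 \<and>
     (\<forall>i. 0 < i \<and> i < length ws - 1 \<longrightarrow> degree E (ws ! i) = 2) \<and>
     distinct (butlast (tl ws)) \<and>
     hd ws \<notin> set (butlast (tl ws)) \<and> last ws \<notin> set (butlast (tl ws))"

definition segments :: "'a set \<Rightarrow> 'a set set \<Rightarrow> 'a set set set" where
  "segments V E = {set (walk_edges ws) | ws. is_segment V E ws}"

definition segment_sequence :: "'a set \<Rightarrow> 'a set set \<Rightarrow> nat list" where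
  "segment_sequence V E = rev (sorted_list_of_multiset (image_mset card (mset_set (segments V E))))"

definition independent :: "'a set set \<Rightarrow> 'a set \<Rightarrow> bool" where
  "independent E S \<longleftrightarrow> (\<forall>u\<in>S. \<forall>v\<in>S. {u, v} \<notin> E)"

definition sigma :: "'a set \<Rightarrow> 'a set set \<Rightarrow> nat" where
  "sigma V E = card {S. S \<subseteq> V \<and> independent E S}"

text \<open>The graph U_{a,b}(s_1..s_t; r_1..r_q): cycle vertices Cyc 0..Cyc(a+b-1),
x = Cyc 0, y = Cyc a; PX i j is the j-th vertex (1 \<le> j \<le> s_i) of the i-th pendent
path at x, PY i j likewise at y.\<close>

datatype uvert = Cyc nat | PX nat nat | PY nat nat

definition U_V :: "nat \<Rightarrow> nat \<Rightarrow> nat list \<Rightarrow> nat list \<Rightarrow> uvert set" where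
  "U_V a b s r = Cyc ` {..<a+b}
     \<union> {PX i j | i j. i < length s \<and> 1 \<le> j \<and> j \<le> s ! i}
     \<union> {PY i j | i j. i < length r \<and> 1 \<le> j \<and> j \<le> r ! i}"

definition U_E :: "nat \<Rightarrow> nat \<Rightarrow> nat list \<Rightarrow> nat list \<Rightarrow> uvert set set" where
  "U_E a b s r = {{Cyc k, Cyc ((k + 1) mod (a + b))} | k. k < a + b}
     \<union> {{Cyc 0, PX i 1} | i. i < length s \<and> 1 \<le> s ! i}
     \<union> {{PX i j, PX i (j + 1)} | i j. i < length s \<and> 1 \<le> j \<and> j < s ! i}
     \<union> {{Cyc a, PY i 1} | i. i < length r \<and> 1 \<le> r ! i}
     \<union> {{PY i j, PY i (j + 1)} | i j. i < length r \<and> 1 \<le> j \<and> j < r ! i}"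

definition U1_V :: "nat \<Rightarrow> nat set" where
  "U1_V n = {..<n}"

definition U1_E :: "nat \<Rightarrow> nat set set" where
  "U1_E n = {{0, 1}, {1, 2}, {0, 2}, {0, 3}, {1, 4}} \<union> {{2, k} | k. 5 \<le> k \<and> k < n}"

end

theory Submission
  imports Defs
begin

text \<open>Let \<open>D\<close> be the set of degree-two vertices. Since no segment is longer than two, \<open>D\<close> is
  independent, so with \<open>k = card D\<close> and \<open>m = card (V - D)\<close> the segment sequence consists of \<open>k\<close> twos
  and \<open>m - k\<close> ones.

  Among trees with prescribed numbers of plain and subdivided edges and a prescribed root, a star
  centred at the root maximises both the number of independent sets and the number of those omitting
  the root. Cut the cycle at a vertex \<open>u\<close> of degree at least three. What remains is the tree hanging
  at \<open>u\<close> and another tree containing both cycle neighbours of \<open>u\<close>; the count is linear in the counts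
  of either tree, hence both may be replaced by stars. This already reduces the problem to cycles with
  two branch vertices, that is, to a comparison of numbers in which the pendant segments are
  distributed optimally. Only when at most one segment has length two and it does not lie on the
  cycle does the reduction lose too much; then the second tree is cut once more, which reduces the
  problem to a triangle with three branch vertices.\<close>

subsection \<open>Independent sets\<close>

text \<open>A star does not maximise the number of independent sets that contain the root, so a tree
  cannot be compared with it term by term. The replacement works because in every cut formula the
  sets containing the root carry the smaller weight; dominating the total and the sets omitting the
  root is then enough (\<open>weighted_le\<close>).

  The parameters are tied together by the fact that a unicyclic graph has as many edges as vertices:
  counting edges by segments, the number of segments equals the number of vertices of degree other
  than two. Hence each piece of a cut can be measured by its unmarked vertices.

  In a star with at least one ray, the sets containing the centre number at most 2/3 of those
  omitting it, with equality for a single ray of length two. This ratio is the source of the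
  constants in the numerical lemmas, and it explains why, when l_3 = 2, a single pendent path at the
  second branch vertex is optimal.\<close>

lemma adj_commute: "adj E u v \<longleftrightarrow> adj E v u"
  by (simp add: adj_def insert_commute)

lemma finite_independent_sets: "finite W \<Longrightarrow> finite {S. S \<subseteq> W \<and> independent E S}"
  by (rule finite_subset[of _ "Pow W"]) auto

lemma sigma_mono: "\<lbrakk>finite W; U \<subseteq> W\<rbrakk> \<Longrightarrow> sigma U E \<le> sigma W E"
  unfolding sigma_def by (rule card_mono[OF finite_independent_sets]) auto

lemma sigma_union:
  assumes "finite X" "finite Y" "X \<inter> Y = {}" "\<And>x y. x \<in> X \<Longrightarrow> y \<in> Y \<Longrightarrow> {x, y} \<notin> E"
  shows "sigma (X \<union> Y) E = sigma X E * sigma Y E"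
proof -
  let ?I = "\<lambda>W. {S. S \<subseteq> W \<and> independent E S}"
  have cross: "{y, x} \<notin> E" if "x \<in> X" "y \<in> Y" for x y
    using assms(4)[OF that] by (simp add: insert_commute)
  have "bij_betw (\<lambda>(S, T). S \<union> T) (?I X \<times> ?I Y) (?I (X \<union> Y))"
  proof (rule bij_betw_byWitness[where f' = "\<lambda>S. (S \<inter> X, S \<inter> Y)"])
    show "\<forall>p\<in>?I X \<times> ?I Y. (\<lambda>S. (S \<inter> X, S \<inter> Y)) (case p of (S, T) \<Rightarrow> S \<union> T) = p"
      using assms(3) by auto
    show "\<forall>S\<in>?I (X \<union> Y). (case (S \<inter> X, S \<inter> Y) of (S, T) \<Rightarrow> S \<union> T) = S"
      by auto
    show "(\<lambda>(S, T). S \<union> T) ` (?I X \<times> ?I Y) \<subseteq> ?I (X \<union> Y)"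
    proof clarify
      fix S T assume S: "S \<subseteq> X" "independent E S" and T: "T \<subseteq> Y" "independent E T"
      have "{u, v} \<notin> E" if "u \<in> S \<union> T" "v \<in> S \<union> T" for u v
        using that S T assms(4)[of u v] cross[of v u] unfolding independent_def by blast
      then show "S \<union> T \<subseteq> X \<union> Y \<and> independent E (S \<union> T)"
        using S T unfolding independent_def by blast
    qed
    show "(\<lambda>S. (S \<inter> X, S \<inter> Y)) ` ?I (X \<union> Y) \<subseteq> ?I X \<times> ?I Y"
      unfolding independent_def by auto
  qed
  then have "card (?I X \<times> ?I Y) = card (?I (X \<union> Y))"
    by (rule bij_betw_same_card)
  then show ?thesis
    by (simp add: sigma_def card_cartesian_product)
qed

text \<open>The two summands count the sets without and with \<open>v\<close>. Since
  \<open>independent\<close> also compares a vertex with itself, a singleton edge at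
  \<open>v\<close> would empty the second class; the last hypothesis excludes this.\<close>

lemma sigma_delete:
  assumes "finite W" "v \<in> W" "{v} \<notin> E"
  shows "sigma W E = sigma (W - {v}) E + sigma (W - {v} - {w. {v, w} \<in> E}) E"
proof -
  let ?I = "\<lambda>W. {S. S \<subseteq> W \<and> independent E S}"
  let ?N = "{w. {v, w} \<in> E}"
  have "?I W = ?I (W - {v}) \<union> insert v ` ?I (W - {v} - ?N)"
  proof (intro equalityI subsetI)
    fix S assume S: "S \<in> ?I W"
    show "S \<in> ?I (W - {v}) \<union> insert v ` ?I (W - {v} - ?N)"
    proof (cases "v \<in> S")
      case True
      then have "S - {v} \<in> ?I (W - {v} - ?N)" using S by (auto simp: independent_def)
      then have "insert v (S - {v}) \<in> insert v ` ?I (W - {v} - ?N)" by (rule imageI)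
      then show ?thesis using True by (simp add: insert_absorb)
    qed (use S in auto)
  next
    fix S assume "S \<in> ?I (W - {v}) \<union> insert v ` ?I (W - {v} - ?N)"
    then show "S \<in> ?I W"
    proof
      assume "S \<in> insert v ` ?I (W - {v} - ?N)"
      then obtain T where T: "S = insert v T" "T \<subseteq> W - {v} - ?N" "independent E T" by auto
      have "{w, v} \<notin> E \<and> {v, w} \<notin> E" if "w \<in> T" for w
        using that T(2) by (simp add: insert_commute[of w v]) blast
      then have "independent E S"
        using T(1,3) assms(3) unfolding independent_def by (metis insert_absorb2 insert_iff)
      then show ?thesis using T assms(2) by auto
    qed auto
  qed
  moreover have "card (insert v ` ?I (W - {v} - ?N)) = card (?I (W - {v} - ?N))"
    by (rule card_image) (auto simp: inj_on_def)
  moreover have "card (?I (W - {v}) \<union> insert v ` ?I (W - {v} - ?N))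
      = card (?I (W - {v})) + card (insert v ` ?I (W - {v} - ?N))"
    by (rule card_Un_disjoint) (use assms finite_independent_sets in auto)
  ultimately show ?thesis by (simp add: sigma_def)
qed

lemma sigma_empty [simp]: "sigma {} E = 1"
proof -
  have "{S. S \<subseteq> {} \<and> independent E S} = {{}}" by (auto simp: independent_def)
  then show ?thesis by (simp add: sigma_def)
qed

lemma sigma_singleton: "{v} \<notin> E \<Longrightarrow> sigma {v} E = 2"
  by (subst sigma_delete[of _ v]) (auto simp: numeral_2_eq_2)

text \<open>Once \<open>u\<close> is deleted no edge joins the two sides, so both terms of
  \<open>sigma_delete\<close> factor. The side \<open>X\<close> enters only through two numbers, the
  sets omitting \<open>u\<close> and those containing it; this is what allows \<open>X\<close> to be
  exchanged for a star.\<close>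

lemma sigma_cut_vertex:
  assumes "finite X" "finite Y" "X \<inter> Y = {}" "u \<in> X" "{u} \<notin> E"
    and "\<And>a b. a \<in> X \<Longrightarrow> b \<in> Y \<Longrightarrow> {a, b} \<in> E \<Longrightarrow> a = u"
  shows "sigma (X \<union> Y) E = sigma (X - {u}) E * sigma Y E
      + sigma (X - {u} - {w. {u, w} \<in> E}) E * sigma (Y - {w. {u, w} \<in> E}) E"
proof -
  let ?N = "{w. {u, w} \<in> E}"
  have "X \<union> Y - {u} = (X - {u}) \<union> Y" "X \<union> Y - {u} - ?N = (X - {u} - ?N) \<union> (Y - ?N)"
    using assms(3,4) by blast+
  moreover have "sigma ((X - {u}) \<union> Y) E = sigma (X - {u}) E * sigma Y E"
    by (rule sigma_union) (use assms(1-3) assms(6) in blast)+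
  moreover have "sigma ((X - {u} - ?N) \<union> (Y - ?N)) E = sigma (X - {u} - ?N) E * sigma (Y - ?N) E"
    by (rule sigma_union) (use assms(1-3) assms(6) in blast)+
  ultimately show ?thesis
    using sigma_delete[of "X \<union> Y" u E] assms(1,2,4,5) by simp
qed

lemma sigma_cut_edge:
  assumes "finite X" "finite Y" "X \<inter> Y = {}" "u \<in> X" "v \<in> Y" "{u, v} \<in> E" "{u} \<notin> E"
    and "\<And>a b. a \<in> X \<Longrightarrow> b \<in> Y \<Longrightarrow> {a, b} \<in> E \<Longrightarrow> a = u \<and> b = v"
  shows "sigma (X \<union> Y) E
      = sigma (X - {u}) E * sigma Y E + sigma (X - {u} - {w. {u, w} \<in> E}) E * sigma (Y - {v}) E"
proof -
  have "Y - {w. {u, w} \<in> E} = Y - {v}" using assms(5,6) assms(8)[OF assms(4)] by blast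
  moreover have "sigma (X \<union> Y) E = sigma (X - {u}) E * sigma Y E
      + sigma (X - {u} - {w. {u, w} \<in> E}) E * sigma (Y - {w. {u, w} \<in> E}) E"
    by (rule sigma_cut_vertex) (use assms(1-4,7) assms(8) in blast)+
  ultimately show ?thesis by simp
qed

subsection \<open>Trees and bridges\<close>

text \<open>An induced subgraph is a tree iff it is connected and all its edges are bridges; this
  form is inherited by the two sides of a cut at an edge.\<close>

definition tree_on :: "'a set set \<Rightarrow> 'a set \<Rightarrow> bool" where
  "tree_on E W \<longleftrightarrow> finite W \<and> W \<noteq> {} \<and> (\<forall>u\<in>W. \<forall>v\<in>W. (adj (E \<inter> Pow W))\<^sup>*\<^sup>* u v) \<and>
     (\<forall>u v. {u, v} \<in> E \<inter> Pow W \<longrightarrow> \<not> (adj (E \<inter> Pow W - {{u, v}}))\<^sup>*\<^sup>* u v)"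

lemma tree_on_cong: "E \<inter> Pow W = F \<inter> Pow W \<Longrightarrow> tree_on E W \<longleftrightarrow> tree_on F W"
  by (simp add: tree_on_def)

lemma adj_rtranclp_commute: "(adj E)\<^sup>*\<^sup>* u v \<Longrightarrow> (adj E)\<^sup>*\<^sup>* v u"
  by (rule sympD[OF symp_rtranclp]) (auto simp: symp_def adj_commute)

lemma adj_rtranclp_mono: "(adj E)\<^sup>*\<^sup>* u v \<Longrightarrow> E \<subseteq> F \<Longrightarrow> (adj F)\<^sup>*\<^sup>* u v"
  by (erule rtranclp_mono[THEN predicate2D, rotated]) (auto simp: adj_def)

lemma reachable_without_edge:
  assumes "(adj F)\<^sup>*\<^sup>* u w"
  shows "(adj (F - {{u, v}}))\<^sup>*\<^sup>* u w \<or> (adj (F - {{u, v}}))\<^sup>*\<^sup>* v w"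
  using assms
proof (induction rule: rtranclp_induct)
  case (step y z)
  show ?case
  proof (cases "{y, z} = {u, v}")
    case True
    then show ?thesis by (auto simp: doubleton_eq_iff)
  next
    case False
    then have "adj (F - {{u, v}}) y z" using step(2) by (simp add: adj_def)
    then show ?thesis using step(3) by (auto intro: rtranclp.rtrancl_into_rtrancl)
  qed
qed simp

lemma reachable_component:
  assumes "(adj F)\<^sup>*\<^sup>* u a"
  shows "(adj (F \<inter> Pow {w. (adj F)\<^sup>*\<^sup>* u w}))\<^sup>*\<^sup>* u a"
  using assms
proof (induction rule: rtranclp_induct)
  case (step y z)
  then have "adj (F \<inter> Pow {w. (adj F)\<^sup>*\<^sup>* u w}) y z"
    by (auto simp: adj_def intro: rtranclp.rtrancl_into_rtrancl)
  then show ?case using step(3) by (rule rtranclp.rtrancl_into_rtrancl[rotated])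
qed simp

text \<open>A bridge stays a bridge when other edges disappear, so only connectedness needs an
  argument, and a walk in a component never leaves it.\<close>

lemma tree_on_component:
  assumes "tree_on E W" "u \<in> W" "F \<subseteq> E \<inter> Pow W"
    "E \<inter> Pow {w. (adj F)\<^sup>*\<^sup>* u w} \<subseteq> F"
  shows "tree_on E {w. (adj F)\<^sup>*\<^sup>* u w}"
proof -
  let ?X = "{w. (adj F)\<^sup>*\<^sup>* u w}"
  have sub: "?X \<subseteq> W"
  proof
    fix w assume "w \<in> ?X"
    then have "(adj F)\<^sup>*\<^sup>* u w" by simp
    then show "w \<in> W" by cases (use assms(2,3) in \<open>auto simp: adj_def\<close>)
  qed
  have eq: "E \<inter> Pow ?X = F \<inter> Pow ?X" using assms(3,4) by auto
  have conn: "(adj (E \<inter> Pow ?X))\<^sup>*\<^sup>* u a" if "a \<in> ?X" for a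
    using reachable_component[of F u a] that unfolding eq by simp
  show "tree_on E ?X"
    unfolding tree_on_def
  proof (intro conjI ballI allI impI)
    show "finite ?X" using sub assms(1) finite_subset unfolding tree_on_def by blast
    show "?X \<noteq> {}" by auto
    fix a b assume "a \<in> ?X" "b \<in> ?X"
    then show "(adj (E \<inter> Pow ?X))\<^sup>*\<^sup>* a b"
      using conn adj_rtranclp_commute rtranclp_trans by metis
  next
    fix a b assume ab: "{a, b} \<in> E \<inter> Pow ?X"
    then have "{a, b} \<in> E \<inter> Pow W" using sub by auto
    then have "\<not> (adj (E \<inter> Pow W - {{a, b}}))\<^sup>*\<^sup>* a b" using assms(1) unfolding tree_on_def by blast
    moreover have "E \<inter> Pow ?X - {{a, b}} \<subseteq> E \<inter> Pow W - {{a, b}}" using sub by auto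
    ultimately show "\<not> (adj (E \<inter> Pow ?X - {{a, b}}))\<^sup>*\<^sup>* a b"
      using adj_rtranclp_mono by metis
  qed
qed

text \<open>The parts are the components of \<open>u\<close> and \<open>v\<close> after their edge
  is deleted; they are disjoint because the edge is a bridge, and they cover \<open>W\<close>
  because a walk crossing the edge can be restarted at one of its ends.\<close>

lemma tree_on_split:
  assumes "tree_on E W" "u \<in> W" "v \<in> W" "{u, v} \<in> E"
  obtains X Y where "X \<union> Y = W" "X \<inter> Y = {}" "u \<in> X" "v \<in> Y" "tree_on E X" "tree_on E Y"
    "\<And>a b. a \<in> X \<Longrightarrow> b \<in> Y \<Longrightarrow> {a, b} \<in> E \<Longrightarrow> a = u \<and> b = v"
proof -
  define F where "F = E \<inter> Pow W - {{u, v}}"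
  define X where "X = {w. (adj F)\<^sup>*\<^sup>* u w}"
  define Y where "Y = {w. (adj F)\<^sup>*\<^sup>* v w}"
  have nr: "\<not> (adj F)\<^sup>*\<^sup>* u v" using assms unfolding tree_on_def F_def by auto
  have disj: "X \<inter> Y = {}"
  proof (rule ccontr)
    assume "X \<inter> Y \<noteq> {}"
    then obtain w where "(adj F)\<^sup>*\<^sup>* u w" "(adj F)\<^sup>*\<^sup>* v w" by (auto simp: X_def Y_def)
    then show False using nr adj_rtranclp_commute rtranclp_trans by metis
  qed
  have uX: "u \<in> X" "v \<in> Y" by (auto simp: X_def Y_def)
  have XF: "E \<inter> Pow X \<subseteq> F" if "X \<subseteq> W" using that disj uX by (auto simp: F_def)
  have YF: "E \<inter> Pow Y \<subseteq> F" if "Y \<subseteq> W" using that disj uX by (auto simp: F_def)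
  have subW: "a \<in> W" if "(adj F)\<^sup>*\<^sup>* b a" "b \<in> W" for a b
    using that by cases (auto simp: adj_def F_def)
  have XW: "X \<subseteq> W" "Y \<subseteq> W" using subW assms by (auto simp: X_def Y_def)
  have FE: "F \<subseteq> E \<inter> Pow W" by (auto simp: F_def)
  have tX: "tree_on E X" "tree_on E Y"
    using tree_on_component[OF assms(1,2) FE] tree_on_component[OF assms(1,3) FE] XF YF XW
    unfolding X_def Y_def by auto
  have "w \<in> X \<union> Y" if "w \<in> W" for w
    using reachable_without_edge[of "E \<inter> Pow W" u w v] assms(1,2) that
    unfolding tree_on_def X_def Y_def F_def by auto
  then have un: "X \<union> Y = W" using XW by auto
  have cross: "a = u \<and> b = v" if "a \<in> X" "b \<in> Y" "{a, b} \<in> E" for a b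
  proof -
    have "{a, b} = {u, v}"
    proof (rule ccontr)
      assume "{a, b} \<noteq> {u, v}"
      then have "adj F a b" using that XW by (auto simp: adj_def F_def)
      then have "b \<in> X" using that(1) unfolding X_def by (auto intro: rtranclp.rtrancl_into_rtrancl)
      then show False using that disj by auto
    qed
    then show ?thesis using that disj uX by (auto simp: doubleton_eq_iff)
  qed
  show ?thesis using that[OF un disj uX tX cross] by blast
qed

lemma tree_on_neighbour:
  assumes "tree_on E W" "r \<in> W" "W \<noteq> {r}"
  obtains x where "x \<in> W" "x \<noteq> r" "{r, x} \<in> E"
proof -
  obtain y where "y \<in> W" "y \<noteq> r" using assms by auto
  then have "(adj (E \<inter> Pow W))\<^sup>*\<^sup>* r y" using assms unfolding tree_on_def by auto
  then obtain x where x: "adj (E \<inter> Pow W) r x"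
    using \<open>y \<noteq> r\<close> by (metis converse_rtranclpE)
  have "x \<noteq> r"
  proof
    assume "x = r"
    then have "{r, r} \<in> E \<inter> Pow W" using x by (simp add: adj_def)
    then show False using assms(1) unfolding tree_on_def by blast
  qed
  then show ?thesis using that x by (auto simp: adj_def)
qed

lemma tree_on_no_loop: "tree_on E W \<Longrightarrow> v \<in> W \<Longrightarrow> {v} \<notin> E"
proof
  assume "tree_on E W" "v \<in> W" "{v} \<in> E"
  then have "{v, v} \<in> E \<inter> Pow W" by auto
  then show False using \<open>tree_on E W\<close> unfolding tree_on_def by blast
qed

text \<open>Splitting at the edge to \<open>v\<close> leaves \<open>d\<close> alone on its side,
  because any further vertex there would give \<open>d\<close> a second neighbour.\<close>

lemma tree_on_remove_leaf:
  assumes "tree_on E W" "d \<in> W" "v \<in> W" "{v, d} \<in> E"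
    and "\<And>w. w \<in> W \<Longrightarrow> {d, w} \<in> E \<Longrightarrow> w = v"
  shows "tree_on E (W - {d})"
proof -
  obtain X Y where s: "X \<union> Y = W" "X \<inter> Y = {}" "v \<in> X" "d \<in> Y" "tree_on E X" "tree_on E Y"
    using tree_on_split[OF assms(1,3,2,4)] by metis
  have "Y = {d}"
  proof (rule ccontr)
    assume "Y \<noteq> {d}"
    then obtain x where "x \<in> Y" "{d, x} \<in> E" using tree_on_neighbour[OF s(6,4)] by metis
    then show False using assms(5)[of x] s(1-4) by blast
  qed
  then have "X = W - {d}" using s by auto
  then show ?thesis using s by simp
qed

text \<open>Any edge splits the tree into two smaller ones whose counts add up. The result later
  converts a number of segments into a number of vertices.\<close>

lemma tree_on_card_edges:
  assumes "tree_on E W" "\<And>e. e \<in> E \<Longrightarrow> \<exists>u v. e = {u, v}"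
  shows "Suc (card (E \<inter> Pow W)) = card W"
  using assms(1)
proof (induction "card W" arbitrary: W rule: less_induct)
  case less
  have fin: "finite W" using less.prems by (simp add: tree_on_def)
  obtain r where r: "r \<in> W" using less.prems by (auto simp: tree_on_def)
  show ?case
  proof (cases "W = {r}")
    case True
    have "E \<inter> Pow W = {}"
    proof (rule ccontr)
      assume "E \<inter> Pow W \<noteq> {}"
      then obtain e where e: "e \<in> E" "e \<subseteq> W" by auto
      then obtain u v where "e = {u, v}" using assms(2) by metis
      then have "{r} \<in> E" using e True by auto
      then show False using tree_on_no_loop[OF less.prems r] by simp
    qed
    then show ?thesis using True by simp
  next
    case False
    then obtain x where x: "x \<in> W" "x \<noteq> r" "{r, x} \<in> E"
      using tree_on_neighbour[OF less.prems r False] by blast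
    obtain X Y where s: "X \<union> Y = W" "X \<inter> Y = {}" "r \<in> X" "x \<in> Y" "tree_on E X" "tree_on E Y"
      and cross: "\<And>a b. a \<in> X \<Longrightarrow> b \<in> Y \<Longrightarrow> {a, b} \<in> E \<Longrightarrow> a = r \<and> b = x"
      using tree_on_split[OF less.prems r x(1,3)] by blast
    have f: "finite X" "finite Y" using fin s(1) by auto
    have c: "card W = card X + card Y" using s f by (metis card_Un_disjoint)
    have pos: "card X > 0" "card Y > 0" using s f card_gt_0_iff by auto
    have IH: "Suc (card (E \<inter> Pow X)) = card X" "Suc (card (E \<inter> Pow Y)) = card Y"
      using less.hyps[OF _ s(5)] less.hyps[OF _ s(6)] c pos by simp_all
    have "E \<inter> Pow W = insert {r, x} (E \<inter> Pow X \<union> E \<inter> Pow Y)"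
    proof (intro equalityI subsetI)
      fix e assume e: "e \<in> E \<inter> Pow W"
      then obtain a b where ab: "e = {a, b}" using assms(2)[of e] by auto
      then have m: "a \<in> X \<union> Y" "b \<in> X \<union> Y" "{a, b} \<in> E" using e s(1) by auto
      moreover have "{b, a} \<in> E" using m(3) by (simp add: insert_commute)
      ultimately have "(a \<in> X \<and> b \<in> X) \<or> (a \<in> Y \<and> b \<in> Y) \<or> e = {r, x}"
        using cross[of a b] cross[of b a] ab by blast
      then show "e \<in> insert {r, x} (E \<inter> Pow X \<union> E \<inter> Pow Y)"
        using m ab by auto
    next
      fix e assume "e \<in> insert {r, x} (E \<inter> Pow X \<union> E \<inter> Pow Y)"
      then show "e \<in> E \<inter> Pow W" using s x r by auto
    qed
    moreover have "{r, x} \<notin> E \<inter> Pow X \<union> E \<inter> Pow Y" using s by auto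
    moreover have "finite (E \<inter> Pow X)" "finite (E \<inter> Pow Y)" using f by auto
    moreover have "(E \<inter> Pow X) \<inter> (E \<inter> Pow Y) = {}"
    proof -
      have "{} \<notin> E" using assms(2)[of "{}"] by auto
      moreover have "e = {}" if "e \<subseteq> X" "e \<subseteq> Y" for e using that s(2) by blast
      ultimately show ?thesis by blast
    qed
    ultimately have "card (E \<inter> Pow W) = Suc (card (E \<inter> Pow X) + card (E \<inter> Pow Y))"
      by (simp add: card_Un_disjoint)
    then show ?thesis using IH c by simp
  qed
qed

subsection \<open>The star bound for trees\<close>


text \<open>Summation by parts: with \<open>x = y + z\<close> both sides become combinations of
  \<open>z\<close> and \<open>y\<close>, with coefficients \<open>A\<close>, \<open>A + B\<close>
  and \<open>a\<close>, \<open>a + b\<close>. A direct comparison of \<open>B\<close> with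
  \<open>b\<close> would fail for stars.\<close>

lemma weighted_le:
  fixes A B a b x y :: nat
  assumes "A \<le> a" "A + B \<le> a + b" "y \<le> x"
  shows "A * x + B * y \<le> a * x + b * y"
proof -
  obtain z where z: "x = y + z" using assms(3) le_Suc_ex by blast
  have "A * x + B * y = A * z + (A + B) * y" by (simp add: z algebra_simps)
  also have "\<dots> \<le> a * z + (a + b) * y" by (intro add_mono mult_right_mono[OF assms(1)] mult_right_mono[OF assms(2)]) auto
  also have "\<dots> = a * x + b * y" by (simp add: z algebra_simps)
  finally show ?thesis .
qed

text \<open>This is \<open>(a - b) * (c - d) \<ge> 0\<close>, expanded so that it lives in the
  naturals.\<close>

lemma cross_products_le:
  fixes a b c d :: nat
  assumes "b \<le> a" "d \<le> c"
  shows "a * d + b * c \<le> a * c + b * d"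
proof -
  obtain x y where "a = b + x" "c = d + y" using assms le_Suc_ex by metis
  then show ?thesis by (simp add: algebra_simps)
qed

text \<open>Vertices in \<open>D\<close> are read as midpoints of segments of length two. A degree-two vertex that
  becomes a leaf of a piece of the graph is not marked there.\<close>

definition subdividing :: "'a set set \<Rightarrow> 'a set \<Rightarrow> 'a set \<Rightarrow> bool" where
  "subdividing E W D \<longleftrightarrow> D \<subseteq> W \<and>
     (\<forall>d\<in>D. \<exists>y\<in>W - D. \<exists>z\<in>W - D. y \<noteq> z \<and> {w \<in> W. {d, w} \<in> E} = {y, z})"

text \<open>A midpoint keeps its mark in a piece only if both of its neighbours stay there; this is
  why \<open>D'\<close> may be smaller than \<open>D \<inter> X\<close>.\<close>

lemma subdividing_restrict:
  assumes "subdividing E W D" "X \<subseteq> W" "D' \<subseteq> D \<inter> X"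
    "\<And>d w. d \<in> D' \<Longrightarrow> w \<in> W \<Longrightarrow> {d, w} \<in> E \<Longrightarrow> w \<in> X"
  shows "subdividing E X D'"
  unfolding subdividing_def
proof (intro conjI ballI)
  fix d assume d: "d \<in> D'"
  then obtain y z where yz: "y \<in> W - D" "z \<in> W - D" "y \<noteq> z" "{w \<in> W. {d, w} \<in> E} = {y, z}"
    using assms(1,3) unfolding subdividing_def by blast
  have eq: "{w \<in> X. {d, w} \<in> E} = {w \<in> W. {d, w} \<in> E}"
    using assms(2) assms(4)[OF d] by blast
  have "y \<in> X - D'" "z \<in> X - D'" using yz assms(3) eq by blast+
  then show "\<exists>y\<in>X - D'. \<exists>z\<in>X - D'. y \<noteq> z \<and> {w \<in> X. {d, w} \<in> E} = {y, z}"
    using yz(3,4) eq by metis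
qed (use assms(3) in blast)

lemma star_weight_le: "(2::nat) ^ q \<le> 2 ^ p * 3 ^ q"
proof -
  have "(2::nat) ^ q \<le> 3 ^ q" by (rule power_mono) auto
  also have "\<dots> \<le> 2 ^ p * 3 ^ q" by simp
  finally show ?thesis .
qed

text \<open>\<open>2 ^ p * 3 ^ q\<close> and \<open>2 ^ q\<close> count the independent sets of a star with \<open>p\<close> plain and \<open>q\<close>
  subdivided rays that omit, respectively contain, its centre.\<close>

lemma tree_star_bound:
  assumes "tree_on E W" "subdividing E W D" "r \<in> W - D"
  shows "\<exists>p. card (W - D) = Suc (p + card D) \<and>
    sigma W E \<le> 2 ^ p * 3 ^ card D + 2 ^ card D \<and> sigma (W - {r}) E \<le> 2 ^ p * 3 ^ card D"
  using assms
proof (induction "card W" arbitrary: W D r rule: less_induct)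
  case less
  note tree = less.prems(1) and sub = less.prems(2)
  have r: "r \<in> W" "r \<notin> D" using less.prems by auto
  have fin: "finite W" using tree by (simp add: tree_on_def)
  have DW: "D \<subseteq> W" using sub by (simp add: subdividing_def)
  have loop: "{v} \<notin> E" if "v \<in> W" for v using tree_on_no_loop[OF tree that] .
  show ?case
  proof (cases "W = {r}")
    case True
    then have "D = {}" using DW r by auto
    then show ?thesis using True sigma_singleton[OF loop[OF r(1)]] by simp
  next
    case False
    obtain x where x: "x \<in> W" "x \<noteq> r" "{r, x} \<in> E"
      using tree_on_neighbour[OF tree r(1) False] by blast
    obtain X Y where s: "X \<union> Y = W" "X \<inter> Y = {}" "r \<in> X" "x \<in> Y" "tree_on E X" "tree_on E Y"
      and cross: "\<And>a b. a \<in> X \<Longrightarrow> b \<in> Y \<Longrightarrow> {a, b} \<in> E \<Longrightarrow> a = r \<and> b = x"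
      using tree_on_split[OF tree r(1) x(1,3)] by blast
    have f: "finite X" "finite Y" "finite D" using fin s(1) DW finite_subset by auto
    have lt: "card X < card W" "card Y < card W"
      using s fin by (auto intro!: psubset_card_mono)
    have cut: "sigma W E = sigma (X - {r}) E * sigma Y E
        + sigma (X - {r} - {w. {r, w} \<in> E}) E * sigma (Y - {x}) E"
      using sigma_cut_edge[OF f(1,2) s(2,3,4) x(3) loop[OF r(1)] cross] s(1) by simp
    have cutr: "sigma (W - {r}) E = sigma (X - {r}) E * sigma Y E"
    proof -
      have "W - {r} = (X - {r}) \<union> Y" using s by auto
      moreover have "sigma ((X - {r}) \<union> Y) E = sigma (X - {r}) E * sigma Y E"
        by (rule sigma_union) (use f s(2) cross in blast)+
      ultimately show ?thesis by simp
    qed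
    have del: "sigma X E = sigma (X - {r}) E + sigma (X - {r} - {w. {r, w} \<in> E}) E"
      by (rule sigma_delete[OF f(1) s(3) loop[OF r(1)]])
    have subX: "subdividing E X (D \<inter> X)"
      by (rule subdividing_restrict[OF sub]) (use s(1) cross r(2) in blast)+
    have rX: "r \<in> X - D \<inter> X" using r s by auto
    obtain p1 where p1: "card (X - D \<inter> X) = Suc (p1 + card (D \<inter> X))"
      "sigma X E \<le> 2 ^ p1 * 3 ^ card (D \<inter> X) + 2 ^ card (D \<inter> X)"
      "sigma (X - {r}) E \<le> 2 ^ p1 * 3 ^ card (D \<inter> X)"
      using less.hyps[OF lt(1) s(5) subX rX] by blast
    define q1 where "q1 = card (D \<inter> X)"
    define a1 :: nat where "a1 = 2 ^ p1 * 3 ^ q1"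
    define b1 :: nat where "b1 = 2 ^ q1"
    have ab1: "b1 \<le> a1" by (simp add: a1_def b1_def star_weight_le)
    have weighted: "sigma (X - {r}) E * s + sigma (X - {r} - {w. {r, w} \<in> E}) E * t \<le> a1 * s + b1 * t"
      if "t \<le> s" for s t
      by (rule weighted_le) (use p1 del that in \<open>auto simp: a1_def b1_def q1_def\<close>)
    show ?thesis
    proof (cases "x \<in> D")
      case False
      have subY: "subdividing E Y (D \<inter> Y)"
      proof (rule subdividing_restrict[OF sub])
        fix d w assume "d \<in> D \<inter> Y" "w \<in> W" "{d, w} \<in> E"
        then show "w \<in> Y" using cross[of w d] s(1) False by (auto simp: insert_commute[of w d])
      qed (use s(1) in blast)+
      have xY: "x \<in> Y - D \<inter> Y" using s False by auto
      obtain p2 where p2: "card (Y - D \<inter> Y) = Suc (p2 + card (D \<inter> Y))"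
        "sigma Y E \<le> 2 ^ p2 * 3 ^ card (D \<inter> Y) + 2 ^ card (D \<inter> Y)"
        "sigma (Y - {x}) E \<le> 2 ^ p2 * 3 ^ card (D \<inter> Y)"
        using less.hyps[OF lt(2) s(6) subY xY] by blast
      define q2 where "q2 = card (D \<inter> Y)"
      define a2 :: nat where "a2 = 2 ^ p2 * 3 ^ q2"
      define b2 :: nat where "b2 = 2 ^ q2"
      have ab2: "b2 \<le> a2" by (simp add: a2_def b2_def star_weight_le)
      have Y: "sigma Y E \<le> a2 + b2" "sigma (Y - {x}) E \<le> a2"
        using p2 by (simp_all add: a2_def b2_def q2_def)
      have D: "D = (D \<inter> X) \<union> (D \<inter> Y)" "W - D = (X - D \<inter> X) \<union> (Y - D \<inter> Y)"
        using DW s by auto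
      have cD: "card D = q1 + q2"
        unfolding q1_def q2_def by (subst D(1), rule card_Un_disjoint) (use f s(2) in auto)
      have cW: "card (W - D) = card (X - D \<inter> X) + card (Y - D \<inter> Y)"
        by (subst D(2), rule card_Un_disjoint) (use f s(2) in auto)
      \<comment> \<open>The rays of both stars are gathered at \<open>r\<close>; the edge from
        \<open>r\<close> to \<open>x\<close> supplies one more plain ray.\<close>
      have a: "2 ^ Suc (p1 + p2) * 3 ^ card D = 2 * (a1 * a2)"
        by (simp add: cD a1_def a2_def power_add)
      have b: "2 ^ card D = b1 * b2"
        by (simp add: cD b1_def b2_def power_add)
      have "sigma W E \<le> a1 * sigma Y E + b1 * sigma (Y - {x}) E"
        unfolding cut by (rule weighted) (rule sigma_mono[OF f(2)], auto)
      also have "\<dots> \<le> a1 * (a2 + b2) + b1 * a2"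
        by (intro add_mono mult_left_mono Y) auto
      \<comment> \<open>The slack is \<open>(a1 - b1) * (a2 - b2)\<close>.\<close>
      also have "\<dots> \<le> 2 * (a1 * a2) + b1 * b2"
        using cross_products_le[OF ab1 ab2] by (simp add: algebra_simps)
      finally have 1: "sigma W E \<le> 2 * (a1 * a2) + b1 * b2" .
      have "sigma (W - {r}) E \<le> a1 * (2 * a2)"
        unfolding cutr by (rule mult_le_mono) (use p1(3) Y(1) ab2 in \<open>auto simp: a1_def q1_def\<close>)
      then have 2: "sigma (W - {r}) E \<le> 2 * (a1 * a2)" by simp
      show ?thesis
        by (rule exI[of _ "Suc (p1 + p2)"], unfold a b)
          (use 1 2 cW p1(1) p2(1) cD in \<open>simp add: q1_def q2_def\<close>)
    next
      case True
      \<comment> \<open>Now \<open>x\<close> is the midpoint of a segment of length two, so the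
        induction is applied to \<open>Y - {x}\<close>, rooted at the far end of that
        segment.\<close>
      obtain y z where yz: "y \<in> W - D" "z \<in> W - D" "y \<noteq> z" "{w \<in> W. {x, w} \<in> E} = {y, z}"
        using sub True unfolding subdividing_def by blast
      have "r \<in> {w \<in> W. {x, w} \<in> E}" using x r by (simp add: insert_commute)
      then obtain y where y: "y \<in> W" "y \<notin> D" "y \<noteq> r" and N: "{w \<in> W. {x, w} \<in> E} = {r, y}"
        using yz by (metis DiffD1 DiffD2 doubleton_eq_iff insertE singletonD)
      have xy: "{x, y} \<in> E" "{y, x} \<in> E" using N by (auto simp: insert_commute)
      have yY: "y \<in> Y" using cross[of y x] y s(1,4) xy(2) by blast
      have yx: "y \<noteq> x" using y True by auto
      have "tree_on E (Y - {x})"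
      proof (rule tree_on_remove_leaf[OF s(6,4) yY xy(2)])
        fix w assume "w \<in> Y" "{x, w} \<in> E"
        then show "w = y" using N s(1,2,3) by blast
      qed
      have subY: "subdividing E (Y - {x}) (D \<inter> Y - {x})"
      proof (rule subdividing_restrict[OF sub])
        fix d w assume d: "d \<in> D \<inter> Y - {x}" "w \<in> W" and "{d, w} \<in> E"
        then have dw: "{w, d} \<in> E" by (simp add: insert_commute)
        have "w \<notin> X" using cross[of w d] d dw by blast
        moreover have "w \<noteq> x"
        proof
          assume "w = x"
          then have "d \<in> {r, y}" using N dw d DW by blast
          then show False using d y r by blast
        qed
        ultimately show "w \<in> Y - {x}" using d s(1) by blast
      qed (use s(1) in blast)+
      have yY': "y \<in> (Y - {x}) - (D \<inter> Y - {x})" using yY yx y by auto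
      have lt': "card (Y - {x}) < card W" using lt(2) card_Diff1_le[of Y x] by linarith
      obtain p2 where p2: "card ((Y - {x}) - (D \<inter> Y - {x})) = Suc (p2 + card (D \<inter> Y - {x}))"
        "sigma (Y - {x}) E \<le> 2 ^ p2 * 3 ^ card (D \<inter> Y - {x}) + 2 ^ card (D \<inter> Y - {x})"
        "sigma (Y - {x} - {y}) E \<le> 2 ^ p2 * 3 ^ card (D \<inter> Y - {x})"
        using less.hyps[OF lt' \<open>tree_on E (Y - {x})\<close> subY yY'] by blast
      define q2 where "q2 = card (D \<inter> Y - {x})"
      define a2 :: nat where "a2 = 2 ^ p2 * 3 ^ q2"
      define b2 :: nat where "b2 = 2 ^ q2"
      have ab2: "b2 \<le> a2" by (simp add: a2_def b2_def star_weight_le)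
      have Y': "sigma (Y - {x}) E \<le> a2 + b2" "sigma (Y - {x} - {y}) E \<le> a2"
        using p2 by (simp_all add: a2_def b2_def q2_def)
      have "Y - {x} - {w. {x, w} \<in> E} = Y - {x} - {y}"
        using N s(1,2,3) by blast
      then have "sigma Y E = sigma (Y - {x}) E + sigma (Y - {x} - {y}) E"
        using sigma_delete[OF f(2) s(4) loop[OF x(1)]] by simp
      then have Y: "sigma Y E \<le> 2 * a2 + b2" using Y' by simp
      have D: "D = (D \<inter> X) \<union> insert x (D \<inter> Y - {x})"
        "W - D = (X - D \<inter> X) \<union> ((Y - {x}) - (D \<inter> Y - {x}))"
        using DW s True by auto
      have cD: "card D = Suc (q1 + q2)"
      proof -
        have "card D = card (D \<inter> X) + card (insert x (D \<inter> Y - {x}))"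
          by (subst D(1), rule card_Un_disjoint) (use f s(2,4) in auto)
        also have "card (insert x (D \<inter> Y - {x})) = Suc (card (D \<inter> Y - {x}))"
          by (rule card_insert_disjoint) (use f in auto)
        finally show ?thesis by (simp add: q1_def q2_def)
      qed
      have cW: "card (W - D) = card (X - D \<inter> X) + card ((Y - {x}) - (D \<inter> Y - {x}))"
        by (subst D(2), rule card_Un_disjoint) (use f s(2) in auto)
      \<comment> \<open>The segment through \<open>x\<close> becomes one more subdivided ray, which
        gives the factor 3.\<close>
      have a: "2 ^ (p1 + p2) * 3 ^ card D = 3 * (a1 * a2)"
        by (simp add: cD a1_def a2_def power_add)
      have b: "2 ^ card D = 2 * (b1 * b2)"
        by (simp add: cD b1_def b2_def power_add)
      have "sigma W E \<le> a1 * sigma Y E + b1 * sigma (Y - {x}) E"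
        unfolding cut by (rule weighted) (rule sigma_mono[OF f(2)], auto)
      also have "\<dots> \<le> a1 * (2 * a2 + b2) + b1 * (a2 + b2)"
        by (intro add_mono mult_left_mono Y Y') auto
      also have "\<dots> \<le> 3 * (a1 * a2) + 2 * (b1 * b2)"
        using cross_products_le[OF ab1 ab2] by (simp add: algebra_simps)
      finally have 1: "sigma W E \<le> 3 * (a1 * a2) + 2 * (b1 * b2)" .
      have "sigma (W - {r}) E \<le> a1 * (3 * a2)"
        unfolding cutr by (rule mult_le_mono) (use p1(3) Y(1) ab2 in \<open>auto simp: a1_def q1_def\<close>)
      then have 2: "sigma (W - {r}) E \<le> 3 * (a1 * a2)" by simp
      show ?thesis
        by (rule exI[of _ "p1 + p2"], unfold a b)
          (use 1 2 cW p1(1) p2(1) cD in \<open>simp add: q1_def q2_def\<close>)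
    qed
  qed
qed

subsection \<open>Edges of a unicyclic graph that are not bridges\<close>

lemma is_walk_append_left: "is_walk E (xs @ ys) \<Longrightarrow> is_walk E xs"
  unfolding is_walk_def
proof (intro allI impI)
  fix i assume *: "\<forall>i. Suc i < length (xs @ ys) \<longrightarrow> adj E ((xs @ ys) ! i) ((xs @ ys) ! Suc i)"
    and "Suc i < length xs"
  then show "adj E (xs ! i) (xs ! Suc i)" using *[rule_format, of i] by (simp add: nth_append)
qed

lemma is_walk_snoc:
  assumes "is_walk E ws" "ws \<noteq> []" "adj E (last ws) z"
  shows "is_walk E (ws @ [z])"
  unfolding is_walk_def
proof (intro allI impI)
  fix i assume i: "Suc i < length (ws @ [z])"
  show "adj E ((ws @ [z]) ! i) ((ws @ [z]) ! Suc i)"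
  proof (cases "Suc i < length ws")
    case True
    then show ?thesis using assms(1) by (simp add: is_walk_def nth_append)
  next
    case False
    then have "i = length ws - 1" using i by simp
    then show ?thesis using assms(2,3) by (simp add: nth_append last_conv_nth)
  qed
qed

lemma walk_edges_snoc:
  assumes "ws \<noteq> []"
  shows "walk_edges (ws @ [z]) = walk_edges ws @ [{last ws, z}]"
proof -
  obtain n where n: "length ws = Suc n" using assms by (cases ws) auto
  have "map (\<lambda>i. {(ws @ [z]) ! i, (ws @ [z]) ! Suc i}) [0..<n] = map (\<lambda>i. {ws ! i, ws ! Suc i}) [0..<n]"
    by (rule map_cong) (auto simp: nth_append n)
  moreover have "(ws @ [z]) ! n = last ws" "(ws @ [z]) ! Suc n = z"
    using n assms by (simp_all add: nth_append last_conv_nth)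
  ultimately show ?thesis by (simp add: walk_edges_def n)
qed

lemma set_walk_edges_subset: "is_walk E ws \<Longrightarrow> set (walk_edges ws) \<subseteq> E"
  by (auto simp: walk_edges_def is_walk_def adj_def)

lemma walk_reachable: "is_walk E ws \<Longrightarrow> ws \<noteq> [] \<Longrightarrow> (adj E)\<^sup>*\<^sup>* (hd ws) (last ws)"
proof (induction ws rule: rev_induct)
  case (snoc z ws)
  show ?case
  proof (cases "ws = []")
    case False
    have "adj E (last ws) z"
      using snoc.prems(1)[unfolded is_walk_def, rule_format, of "length ws - 1"] False
      by (simp add: nth_append last_conv_nth)
    then show ?thesis
      using snoc.IH[OF is_walk_append_left[OF snoc.prems(1)] False] False
      by (auto intro: rtranclp.rtrancl_into_rtrancl)
  qed simp
qed simp

lemma reachable_simple_walk: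
  assumes "(adj E)\<^sup>*\<^sup>* p q"
  shows "\<exists>ws. ws \<noteq> [] \<and> hd ws = p \<and> last ws = q \<and> distinct ws \<and> is_walk E ws"
  using assms
proof (induction rule: rtranclp_induct)
  case base
  show ?case by (rule exI[of _ "[p]"]) (simp add: is_walk_def)
next
  case (step y z)
  then obtain ws where ws: "ws \<noteq> []" "hd ws = p" "last ws = y" "distinct ws" "is_walk E ws"
    by blast
  show ?case
  proof (cases "z \<in> set ws")
    case True
    then obtain as bs where "ws = as @ z # bs" by (meson split_list)
    then have "ws = (as @ [z]) @ bs" by simp
    moreover from this have "hd (as @ [z]) = p" using ws(2) by (cases as) auto
    ultimately show ?thesis
      using ws(4,5) is_walk_append_left by (intro exI[of _ "as @ [z]"]) fastforce
  next
    case False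
    then show ?thesis
      using ws step(2) by (intro exI[of _ "ws @ [z]"]) (simp add: is_walk_snoc)
  qed
qed

lemma simple_graph_edgeD:
  assumes "simple_graph V E" "{u, v} \<in> E"
  shows "u \<noteq> v" "u \<in> V" "v \<in> V"
proof -
  obtain x y where "{u, v} = {x, y}" "x \<noteq> y" "x \<in> V" "y \<in> V"
    using assms unfolding simple_graph_def by metis
  then show "u \<noteq> v" "u \<in> V" "v \<in> V" by (auto simp: doubleton_eq_iff)
qed

text \<open>The edge closes a simple walk that avoids it. Keeping the cycle inside \<open>F\<close>
  is what later tells two cycles apart.\<close>

lemma cycle_through_edge:
  assumes G: "simple_graph V E" and F: "F \<subseteq> E" "{p, q} \<in> F"
    and pq: "(adj (F - {{p, q}}))\<^sup>*\<^sup>* p q"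
  obtains K where "K \<in> cycles V E" "{p, q} \<in> K" "K \<subseteq> F"
proof -
  obtain vs where vs: "vs \<noteq> []" "hd vs = p" "last vs = q" "distinct vs" "is_walk (F - {{p, q}}) vs"
    using reachable_simple_walk[OF pq] by metis
  have walkF: "is_walk F vs" using vs(5) by (simp add: is_walk_def adj_def)
  have walk: "is_walk E vs" using walkF F(1) by (auto simp: is_walk_def adj_def)
  have "p \<noteq> q" using simple_graph_edgeD(1)[OF G] F by blast
  have len: "length vs \<ge> 3"
  proof (rule ccontr)
    assume "\<not> length vs \<ge> 3"
    moreover obtain n where "length vs = Suc n" using vs(1) by (cases vs) auto
    ultimately consider "length vs = 1" | "length vs = 2" by linarith
    then show False
    proof cases
      case 1
      then show False using vs(2,3) \<open>p \<noteq> q\<close> by (auto simp: length_Suc_conv)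
    next
      case 2
      then have "vs = [p, q]" using vs(2,3) by (auto simp: numeral_2_eq_2 length_Suc_conv)
      then have "adj (F - {{p, q}}) p q" using vs(5) by (force simp: is_walk_def)
      then show False by (simp add: adj_def)
    qed
  qed
  have "set vs \<subseteq> V"
  proof
    fix v assume "v \<in> set vs"
    then obtain i where i: "i < length vs" "v = vs ! i" by (auto simp: in_set_conv_nth)
    show "v \<in> V"
    proof (cases i)
      case 0
      then have "adj E v (vs ! 1)" using walk i len by (simp add: is_walk_def)
      then show ?thesis using simple_graph_edgeD[OF G] by (simp add: adj_def)
    next
      case (Suc j)
      then have "adj E (vs ! j) v" using walk i by (simp add: is_walk_def)
      then show ?thesis using simple_graph_edgeD[OF G] by (simp add: adj_def)
    qed
  qed
  moreover have "adj E (last vs) (hd vs)" using vs F by (auto simp: adj_def insert_commute)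
  ultimately have "cycle_edges vs \<in> cycles V E"
    using len vs(4) walk unfolding cycles_def is_cycle_list_def by blast
  moreover have "cycle_edges vs = insert {p, q} (set (walk_edges vs))"
    using vs(1-3) by (auto simp: cycle_edges_def walk_edges_snoc insert_commute)
  ultimately show ?thesis
    using set_walk_edges_subset[OF walkF] F(2) by (intro that[of "cycle_edges vs"]) simp_all
qed

lemma unicyclic_nonbridge:
  assumes "unicyclic V E"
  obtains u v where "{u, v} \<in> E" "(adj (E - {{u, v}}))\<^sup>*\<^sup>* u v"
proof -
  have "cycles V E \<noteq> {}" using assms by (auto simp: unicyclic_def)
  then obtain vs where vs: "length vs \<ge> 3" "distinct vs" "is_walk E vs" "adj E (last vs) (hd vs)"
    unfolding cycles_def is_cycle_list_def by blast
  let ?e = "{hd vs, last vs}"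
  have "is_walk (E - {?e}) vs"
    unfolding is_walk_def
  proof (intro allI impI)
    fix i assume i: "Suc i < length vs"
    have h: "hd vs = vs ! 0" "last vs = vs ! (length vs - 1)"
      using vs(1) by (auto simp: hd_conv_nth last_conv_nth simp flip: length_greater_0_conv)
    have "{vs ! i, vs ! Suc i} \<noteq> ?e"
    proof
      assume "{vs ! i, vs ! Suc i} = ?e"
      then have "(vs ! i = vs ! 0 \<and> vs ! Suc i = vs ! (length vs - 1)) \<or> vs ! i = vs ! (length vs - 1)"
        unfolding h by (auto simp: doubleton_eq_iff)
      moreover have "i < length vs" "0 < length vs" "length vs - 1 < length vs" using vs(1) i by linarith+
      ultimately have "(i = 0 \<and> Suc i = length vs - 1) \<or> i = length vs - 1"
        using vs(2) i nth_eq_iff_index_eq by metis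
      then show False using i vs(1) by linarith
    qed
    then show "adj (E - {?e}) (vs ! i) (vs ! Suc i)" using vs(3) i by (simp add: is_walk_def adj_def)
  qed
  then have "(adj (E - {?e}))\<^sup>*\<^sup>* (hd vs) (last vs)" by (rule walk_reachable) (use vs(1) in auto)
  moreover have "?e \<in> E" using vs(4) by (simp add: adj_def insert_commute)
  ultimately show ?thesis using that by blast
qed

text \<open>If some remaining edge were still not a bridge, there would be two cycles, one avoiding
  \<open>{u, v}\<close> and one containing it.\<close>

lemma unicyclic_remove_nonbridge:
  assumes "unicyclic V E" "{u, v} \<in> E" "(adj (E - {{u, v}}))\<^sup>*\<^sup>* u v"
  shows "tree_on (E - {{u, v}}) V"
proof -
  let ?F = "E - {{u, v}}"
  have G: "simple_graph V E" and conn: "connected_graph V E" and one: "card (cycles V E) = 1"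
    using assms(1) by (auto simp: unicyclic_def)
  have FV: "?F \<inter> Pow V = ?F" using G by (auto simp: simple_graph_def)
  have uV: "u \<in> V" "v \<in> V" using simple_graph_edgeD[OF G assms(2)] by auto
  have from_u: "(adj ?F)\<^sup>*\<^sup>* u w" if "w \<in> V" for w
  proof -
    have "(adj E)\<^sup>*\<^sup>* u w" using conn uV that by (auto simp: connected_graph_def)
    from reachable_without_edge[OF this, of v] show ?thesis using assms(3) rtranclp_trans by metis
  qed
  show ?thesis
    unfolding tree_on_def FV
  proof (intro conjI ballI allI impI notI)
    show "finite V" using G by (simp add: simple_graph_def)
    show False if "V = {}" using that uV by simp
    fix a b assume "a \<in> V" "b \<in> V"
    then show "(adj ?F)\<^sup>*\<^sup>* a b" using from_u adj_rtranclp_commute rtranclp_trans by metis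
  next
    fix a b assume ab: "{a, b} \<in> ?F" "(adj (?F - {{a, b}}))\<^sup>*\<^sup>* a b"
    obtain K where K: "K \<in> cycles V E" "K \<subseteq> ?F"
      using cycle_through_edge[OF G _ ab] by blast
    obtain L where L: "L \<in> cycles V E" "{u, v} \<in> L"
      using cycle_through_edge[OF G order_refl assms(2,3)] by blast
    have "K = L" using one K(1) L(1) by (metis card_1_singletonE singletonD)
    then show False using K(2) L(2) by blast
  qed
qed

text \<open>The walk is restarted at its last visit to \<open>u\<close>, so everything after the
  first step avoids \<open>u\<close>. Applied on the cycle, this yields the next cycle
  vertex.\<close>

lemma reachable_first_step:
  assumes "(adj F)\<^sup>*\<^sup>* u x" "u \<noteq> x"
  obtains x' where "{u, x'} \<in> F" "(adj (F - {{u, x'}}))\<^sup>*\<^sup>* x' x"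
proof -
  have "u = x \<or> (\<exists>x'. {u, x'} \<in> F \<and> (adj {e \<in> F. u \<notin> e})\<^sup>*\<^sup>* x' x)"
    using assms(1)
  proof (induction rule: rtranclp_induct)
    case (step y z)
    show ?case
    proof (cases "u = z \<or> u = y")
      case True
      then show ?thesis using step(2) by (auto simp: adj_def)
    next
      case False
      then have "adj {e \<in> F. u \<notin> e} y z" using step(2) by (auto simp: adj_def)
      then show ?thesis using step(3) False by (metis rtranclp.rtrancl_into_rtrancl)
    qed
  qed simp
  then obtain x' where x': "{u, x'} \<in> F" "(adj {e \<in> F. u \<notin> e})\<^sup>*\<^sup>* x' x"
    using assms(2) by blast
  moreover have "{e \<in> F. u \<notin> e} \<subseteq> F - {{u, x'}}" by auto
  ultimately show ?thesis using that adj_rtranclp_mono by metis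
qed

subsection \<open>Segments of length at most two\<close>

lemma finite_neighbours:
  assumes "simple_graph V E"
  shows "finite {w. {v, w} \<in> E}"
proof -
  have "{w. {v, w} \<in> E} \<subseteq> V" using simple_graph_edgeD(3)[OF assms] by blast
  then show ?thesis using assms finite_subset by (auto simp: simple_graph_def)
qed

lemma incident_edges: "simple_graph V E \<Longrightarrow> {e \<in> E. v \<in> e} = (\<lambda>w. {v, w}) ` {w. {v, w} \<in> E}"
proof (intro equalityI subsetI)
  fix e assume "simple_graph V E" "e \<in> {e \<in> E. v \<in> e}"
  then obtain a b where "e = {a, b}" "e \<in> E" "v \<in> {a, b}" unfolding simple_graph_def by blast
  then show "e \<in> (\<lambda>w. {v, w}) ` {w. {v, w} \<in> E}"
    by (cases "v = a") (auto simp: insert_commute)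
qed auto

lemma card_incident_edges: "simple_graph V E \<Longrightarrow> card {e \<in> E. v \<in> e} = degree E v"
  unfolding incident_edges degree_def by (rule card_image) (auto simp: inj_on_def doubleton_eq_iff)

lemma exists_boundary_step:
  assumes "(adj E)\<^sup>*\<^sup>* h d" "\<not> P h" "P d"
  shows "\<exists>x y. adj E x y \<and> \<not> P x \<and> P y"
  using assms by (induction rule: rtranclp_induct) blast+

text \<open>A bare cycle has no segments at all; \<open>h\<close> is there to provide an end. A walk
  from \<open>h\<close> enters a run of adjacent degree-two vertices, and the run is followed until
  it leaves degree two.\<close>

lemma long_segment_exists:
  assumes G: "simple_graph V E" and conn: "connected_graph V E"
    and h: "h \<in> V" "degree E h \<noteq> 2"
    and d: "degree E d = 2" "degree E d' = 2" "adj E d d'"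
  shows "\<exists>s\<in>segments V E. card s \<ge> 3"
proof -
  note edge = simple_graph_edgeD[OF G]
  have finV: "finite V" using G by (simp add: simple_graph_def)
  \<comment> \<open>A vertex that fails \<open>?P\<close> but is adjacent to one satisfying it
    cannot have degree two, so the edge where \<open>?P\<close> starts to hold begins a
    segment.\<close>
  let ?P = "\<lambda>v. degree E v = 2 \<and> (\<exists>w. adj E v w \<and> degree E w = 2)"
  have "d \<in> V" using d(3) edge by (auto simp: adj_def)
  then have "(adj E)\<^sup>*\<^sup>* h d" using conn h by (auto simp: connected_graph_def)
  then obtain x y where xy: "adj E x y" "\<not> ?P x" "?P y"
    using exists_boundary_step[of E h d ?P] h d by blast
  then have x: "degree E x \<noteq> 2" by blast
  obtain y' where y': "adj E y y'" "degree E y' = 2" using xy(3) by blast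
  \<comment> \<open>\<open>us\<close> is the interior beyond \<open>y\<close>; being nonempty, it
    guarantees at least three edges in the end. The start \<open>x\<close> differs from the interior
    by its degree.\<close>
  define Q where "Q us \<longleftrightarrow> us \<noteq> [] \<and> distinct (y # us) \<and> (\<forall>v\<in>set us. degree E v = 2) \<and>
    is_walk E (x # y # us)" for us
  have walk3: "is_walk E [x, y, y']"
    using is_walk_snoc[of E "[x, y]" y'] is_walk_snoc[of E "[x]" y] xy(1) y'(1)
    by (simp add: is_walk_def)
  have "y \<noteq> y'" using y'(1) edge(1) by (auto simp: adj_def)
  then have Q0: "Q [y']" using walk3 y'(2) by (simp add: Q_def)
  have walkV: "set (a # b # us) \<subseteq> V" if "is_walk E (a # b # us)" for a b us
  proof
    fix v assume "v \<in> set (a # b # us)"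
    then obtain i where i: "i < length (a # b # us)" "v = (a # b # us) ! i"
      by (metis in_set_conv_nth)
    show "v \<in> V"
    proof (cases i)
      case 0
      then have "adj E v b" using that[unfolded is_walk_def, rule_format, of 0] i by simp
      then show ?thesis using edge by (auto simp: adj_def)
    next
      case (Suc j)
      then have "adj E ((a # b # us) ! j) v" using that[unfolded is_walk_def, rule_format, of j] i by simp
      then show ?thesis using edge by (auto simp: adj_def)
    qed
  qed
  have "length us < Suc (card V)" if "Q us" for us
  proof -
    have "set us \<subseteq> V" "distinct us" using that walkV[of x y us] by (auto simp: Q_def)
    then show ?thesis using finV by (metis card_mono distinct_card le_imp_less_Suc)
  qed
  then obtain us where us: "Q us" and max: "\<And>vs. Q vs \<Longrightarrow> length vs \<le> length us"
    using ex_has_greatest_nat[of Q "[y']" length "Suc (card V)"] Q0 by blast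
  define ws where "ws = x # y # us"
  define N where "N = length ws"
  have N3: "N \<ge> 3" using us by (cases us) (auto simp: N_def ws_def Q_def)
  have walk: "is_walk E ws" using us by (simp add: Q_def ws_def)
  have inner: "degree E (ws ! i) = 2" if "1 \<le> i" "i < N" for i
  proof -
    have "ws ! i = (y # us) ! (i - 1)" "i - 1 < length (y # us)"
      using that by (auto simp: ws_def N_def nth_Cons')
    then have "ws ! i \<in> set (y # us)" by (metis nth_mem)
    then show ?thesis using us xy(3) by (auto simp: Q_def)
  qed
  have inj: "i = j" if "ws ! i = ws ! j" "1 \<le> i" "i < N" "1 \<le> j" "j < N" for i j
  proof -
    have "(y # us) ! (i - 1) = (y # us) ! (j - 1)" "i - 1 < length (y # us)" "j - 1 < length (y # us)"
      using that by (auto simp: ws_def N_def nth_Cons')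
    moreover have "distinct (y # us)" using us by (simp add: Q_def)
    ultimately have "i - 1 = j - 1" by (simp only: nth_eq_iff_index_eq)
    then show ?thesis using that by simp
  qed
  have ws0: "ws ! 0 = x" by (simp add: ws_def)
  have inj0: "i = j" if "ws ! i = ws ! j" "i < N" "1 \<le> j" "j < N" for i j
    using that inj[of i j] inner[of j] ws0 x by (cases "i = 0") auto
  have ne: "ws ! i \<noteq> ws ! j" if "i < j" "j < N" for i j using inj0[of i j] that by auto
  have step: "{ws ! i, ws ! Suc i} \<in> E" if "Suc i < N" for i
    using walk that by (simp add: is_walk_def adj_def N_def)
  have last: "last ws = ws ! (N - 1)" by (simp add: N_def ws_def last_conv_nth)
  let ?z = "ws ! (N - 1)" and ?p = "ws ! (N - 2)"
  have zp: "{?z, ?p} \<in> E" using step[of "N - 2"] N3 by (simp add: insert_commute Suc_diff_Suc numeral_2_eq_2)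
  \<comment> \<open>The last interior vertex has one neighbour besides its predecessor. Maximality
    of \<open>us\<close> will force it to be an end of the segment.\<close>
  have "card {w. {?z, w} \<in> E} = 2" using inner[of "N - 1"] N3 by (simp add: degree_def)
  then obtain w where w: "{?z, w} \<in> E" "w \<noteq> ?p"
    using zp by (metis (no_types, lifting) card_2_iff mem_Collect_eq insert_iff)
  have w2: "degree E w \<noteq> 2"
  proof
    assume w2: "degree E w = 2"
    show False
    proof (cases "w \<in> set (y # us)")
      case False
      have "is_walk E (ws @ [w])"
        by (rule is_walk_snoc[OF walk]) (use w last in \<open>auto simp: ws_def adj_def\<close>)
      then have "Q (us @ [w])" using us False w2 by (auto simp: Q_def ws_def)
      then show False using max by fastforce
    next
      case True
      then obtain j where "j < length (y # us)" "w = (y # us) ! j" by (metis in_set_conv_nth)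
      then obtain i where i: "1 \<le> i" "i < N" "w = ws ! i"
        using that[of "Suc j"] by (auto simp: ws_def N_def)
      have "i \<noteq> N - 1" using i w(1) edge(1) by metis
      moreover have "i \<noteq> N - 2" using i w(2) by metis
      ultimately have iN: "Suc i < N - 1" using i by linarith
      \<comment> \<open>If the walk ran back into its own interior at \<open>w\<close>, then
        \<open>w\<close> would have three neighbours.\<close>
      let ?T = "{ws ! (i - 1), ws ! Suc i, ?z}"
      have "ws ! (i - 1) \<noteq> ws ! Suc i" by (rule ne) (use iN in linarith)+
      moreover have "ws ! (i - 1) \<noteq> ?z" by (rule ne) (use iN in linarith)+
      moreover have "ws ! Suc i \<noteq> ?z" by (rule ne) (use iN in linarith)+
      ultimately have "card ?T = 3" by simp
      moreover have "?T \<subseteq> {v. {w, v} \<in> E}"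
        using step[of "i - 1"] step[of i] w(1) i iN by (auto simp: insert_commute)
      ultimately have "3 \<le> degree E w"
        using card_mono[OF finite_neighbours[OF G], of ?T w] by (simp add: degree_def)
      then show False using w2 by simp
    qed
  qed
  let ?s = "ws @ [w]"
  have walks: "is_walk E ?s"
    by (rule is_walk_snoc[OF walk]) (use w last in \<open>auto simp: ws_def adj_def\<close>)
  have nth: "?s ! i = ws ! i" if "i < N" for i using that by (simp add: nth_append N_def)
  have nthN: "?s ! N = w" by (simp add: N_def)
  \<comment> \<open>Since \<open>w\<close> may coincide with \<open>x\<close>, the vertices need not
    be distinct. A repeated edge would force the walk to turn back at once, that is
    \<open>j = Suc i\<close>.\<close>
  have "i = j" if eq: "{?s ! i, ?s ! Suc i} = {?s ! j, ?s ! Suc j}" and ij: "i < N" "j < N" "i \<le> j" for i j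
  proof (rule ccontr)
    assume "i \<noteq> j"
    then have lt: "i < j" "1 \<le> j" using ij by auto
    have "?s ! j = ?s ! i \<or> ?s ! j = ?s ! Suc i" using eq by (auto simp: doubleton_eq_iff)
    then have "ws ! i = ws ! j \<or> ws ! Suc i = ws ! j" using nth ij lt by auto
    then have j: "j = Suc i" using inj0[of i j] inj0[of "Suc i" j] lt ij by auto
    then have turn: "?s ! Suc j = ws ! i" using eq nth ij lt by (auto simp: doubleton_eq_iff)
    show False
    proof (cases "Suc j = N")
      case True
      then have "1 \<le> i" using j N3 by linarith
      then have "degree E (ws ! i) = 2" using inner ij by blast
      then show False using turn True nthN w2 by simp
    next
      case False
      then have "ws ! i = ws ! Suc j" using turn nth[of "Suc j"] ij by simp
      then show False using inj0[of i "Suc j"] ij False j by auto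
    qed
  qed
  then have dist: "distinct (walk_edges ?s)"
    unfolding walk_edges_def distinct_map
    by (auto simp: inj_on_def N_def) (metis nat_le_linear)
  have "set ?s \<subseteq> V" using walkV[of x y us] walk w(1) edge(3) by (auto simp: ws_def)
  moreover have "length ?s \<ge> 2" "hd ?s = x" "last ?s = w" by (simp_all add: ws_def)
  moreover have "butlast (tl ?s) = y # us" by (simp add: ws_def butlast_append)
  moreover have "\<forall>v\<in>set (y # us). degree E v = 2" using us xy(3) by (simp add: Q_def)
  moreover have "distinct (y # us)" using us by (simp add: Q_def)
  moreover have "\<forall>i. 0 < i \<and> i < length ?s - 1 \<longrightarrow> degree E (?s ! i) = 2"
    using inner nth by (auto simp: N_def)
  ultimately have "is_segment V E ?s"
    using x w2 dist walks unfolding is_segment_def by metis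
  moreover have "card (set (walk_edges ?s)) = N"
    using distinct_card[OF dist] by (simp add: walk_edges_def N_def)
  ultimately show ?thesis using N3 unfolding segments_def by blast
qed

text \<open>A fourth vertex on a segment would make two interior vertices adjacent. So a segment is
  one edge or the pair of edges at its interior vertex; indexing the latter by that vertex removes
  the choice of direction.\<close>

lemma segments_eq:
  assumes G: "simple_graph V E"
    and indep: "\<And>u v. degree E u = 2 \<Longrightarrow> degree E v = 2 \<Longrightarrow> \<not> adj E u v"
  shows "segments V E = (\<lambda>e. {e}) ` {e \<in> E. \<forall>v\<in>e. degree E v \<noteq> 2}
    \<union> (\<lambda>d. {e \<in> E. d \<in> e}) ` {v \<in> V. degree E v = 2}"
proof (intro equalityI subsetI)
  fix s assume "s \<in> segments V E"
  then obtain ws where s: "s = set (walk_edges ws)" and seg: "is_segment V E ws"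
    by (auto simp: segments_def)
  have walk: "is_walk E ws" and inner: "\<And>i. 0 < i \<Longrightarrow> i < length ws - 1 \<Longrightarrow> degree E (ws ! i) = 2"
    and ends: "degree E (hd ws) \<noteq> 2" "degree E (last ws) \<noteq> 2" and len: "length ws \<ge> 2"
    and V: "set ws \<subseteq> V" and dist: "distinct (walk_edges ws)"
    using seg by (auto simp: is_segment_def)
  have "length ws < 4"
  proof (rule ccontr)
    assume "\<not> length ws < 4"
    then have "degree E (ws ! 1) = 2" "degree E (ws ! 2) = 2" "adj E (ws ! 1) (ws ! 2)"
      using inner walk[unfolded is_walk_def, rule_format, of 1] by (auto simp: numeral_2_eq_2)
    then show False using indep by blast
  qed
  then consider a b where "ws = [a, b]" | a d b where "ws = [a, d, b]"
  proof -
    have "length ws = 2 \<or> length ws = 3" using len \<open>length ws < 4\<close> by linarith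
    then show ?thesis
      using that by (auto simp: numeral_2_eq_2 numeral_3_eq_3 length_Suc_conv)
  qed
  then show "s \<in> (\<lambda>e. {e}) ` {e \<in> E. \<forall>v\<in>e. degree E v \<noteq> 2}
    \<union> (\<lambda>d. {e \<in> E. d \<in> e}) ` {v \<in> V. degree E v = 2}"
  proof cases
    case 1
    then have "s = {{a, b}}" using s by (simp add: walk_edges_def)
    moreover have "{a, b} \<in> E" using walk[unfolded is_walk_def, rule_format, of 0] 1 by (simp add: adj_def)
    ultimately show ?thesis using ends 1 by auto
  next
    case 2
    have sE: "s = {{a, d}, {d, b}}" "{a, d} \<noteq> {d, b}"
      using s dist 2 by (auto simp: walk_edges_def upt_rec)
    have dd: "degree E d = 2" using inner[of 1] 2 by simp
    have "s \<subseteq> {e \<in> E. d \<in> e}" using set_walk_edges_subset[OF walk] s sE by auto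
    moreover have "card s = card {e \<in> E. d \<in> e}"
      unfolding card_incident_edges[OF G] dd using sE by simp
    moreover have "finite {e \<in> E. d \<in> e}"
      using incident_edges[OF G, of d] finite_neighbours[OF G, of d] by simp
    ultimately have "s = {e \<in> E. d \<in> e}" by (metis card_subset_eq)
    then show ?thesis using dd V 2 by auto
  qed
next
  fix s assume "s \<in> (\<lambda>e. {e}) ` {e \<in> E. \<forall>v\<in>e. degree E v \<noteq> 2}
    \<union> (\<lambda>d. {e \<in> E. d \<in> e}) ` {v \<in> V. degree E v = 2}"
  then show "s \<in> segments V E"
  proof
    assume "s \<in> (\<lambda>e. {e}) ` {e \<in> E. \<forall>v\<in>e. degree E v \<noteq> 2}"
    then obtain e where e: "e \<in> E" "s = {e}" "\<forall>v\<in>e. degree E v \<noteq> 2" by auto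
    obtain a b where ab: "e = {a, b}" "a \<in> V" "b \<in> V" using e G unfolding simple_graph_def by blast
    have "is_segment V E [a, b]"
      using e ab by (auto simp: is_segment_def walk_edges_def is_walk_def adj_def)
    moreover have "s = set (walk_edges [a, b])" using e ab by (simp add: walk_edges_def)
    ultimately show ?thesis unfolding segments_def by blast
  next
    assume "s \<in> (\<lambda>d. {e \<in> E. d \<in> e}) ` {v \<in> V. degree E v = 2}"
    then obtain d where d: "d \<in> V" "degree E d = 2" "s = {e \<in> E. d \<in> e}" by auto
    obtain a b where ab: "{w. {d, w} \<in> E} = {a, b}" "a \<noteq> b"
      using d(2) unfolding degree_def card_2_iff by blast
    have E: "{a, d} \<in> E" "{d, b} \<in> E" using ab by (auto simp: insert_commute)
    have ne: "a \<noteq> d" "b \<noteq> d" using E simple_graph_edgeD(1)[OF G] by blast+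
    have nd: "degree E a \<noteq> 2" "degree E b \<noteq> 2"
      using indep[of d b] indep[of a d] d E by (auto simp: adj_def)
    have we: "walk_edges [a, d, b] = [{a, d}, {d, b}]" by (simp add: walk_edges_def upt_rec)
    have "is_walk E [a, d, b]"
      using E by (auto simp: is_walk_def adj_def less_Suc_eq)
    moreover have "{a, d} \<noteq> {d, b}" using ab ne by (auto simp: doubleton_eq_iff)
    moreover have "a \<in> V" "b \<in> V" using E simple_graph_edgeD[OF G] by blast+
    ultimately have "is_segment V E [a, d, b]"
      using we d nd ne by (auto simp: is_segment_def less_Suc_eq)
    moreover have "s = set (walk_edges [a, d, b])"
      unfolding d(3) incident_edges[OF G] ab(1) we by (auto simp: insert_commute)
    ultimately show ?thesis unfolding segments_def by blast
  qed
qed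

lemma sorted_le_last: "sorted xs \<Longrightarrow> x \<in> set xs \<Longrightarrow> x \<le> last xs"
  by (induction xs) auto

lemma unicyclic_card_edges:
  assumes "unicyclic V E"
  shows "card E = card V"
proof -
  have G: "simple_graph V E" using assms by (simp add: unicyclic_def)
  obtain u v where uv: "{u, v} \<in> E" "(adj (E - {{u, v}}))\<^sup>*\<^sup>* u v"
    using unicyclic_nonbridge[OF assms] by metis
  have "tree_on (E - {{u, v}}) V" by (rule unicyclic_remove_nonbridge[OF assms uv])
  moreover have "\<exists>a b. e = {a, b}" if "e \<in> E - {{u, v}}" for e
    using that G unfolding simple_graph_def by blast
  ultimately have "Suc (card ((E - {{u, v}}) \<inter> Pow V)) = card V"
    by (rule tree_on_card_edges)
  moreover have sub: "E \<subseteq> Pow V" using G by (auto simp: simple_graph_def)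
  moreover have "finite E" using sub G finite_subset by (auto simp: simple_graph_def)
  moreover have "(E - {{u, v}}) \<inter> Pow V = E - {{u, v}}" using sub by auto
  ultimately show ?thesis using card_Suc_Diff1[OF _ uv(1)] by simp
qed

text \<open>By independence an edge meets at most one vertex of \<open>D\<close>, so
  \<open>card E\<close> is \<open>2 * card D\<close> plus the number of edges that avoid
  \<open>D\<close>. Together with \<open>card E = card V\<close>, the number of segments becomes
  \<open>card (V - D)\<close>.\<close>

lemma unicyclic_short_segments:
  assumes uni: "unicyclic V E" and seq: "segment_sequence V E = ls" and ne: "ls \<noteq> []" and short: "ls ! 0 \<le> 2"
  defines "D \<equiv> {v \<in> V. degree E v = 2}"
  shows "\<And>u v. degree E u = 2 \<Longrightarrow> degree E v = 2 \<Longrightarrow> \<not> adj E u v"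
    and "card D \<le> card (V - D)"
    and "ls = replicate (card D) 2 @ replicate (card (V - D) - card D) 1"
proof -
  have G: "simple_graph V E" and conn: "connected_graph V E" using uni by (auto simp: unicyclic_def)
  have finV: "finite V" using G by (simp add: simple_graph_def)
  have sub: "E \<subseteq> Pow V" using G by (auto simp: simple_graph_def)
  then have finE: "finite E" using finV finite_subset by auto
  have "segments V E \<subseteq> Pow E"
    unfolding segments_def is_segment_def using set_walk_edges_subset by blast
  then have finS: "finite (segments V E)" using finE finite_subset by auto
  have set_ls: "set ls = card ` segments V E"
    using finS by (simp flip: seq add: segment_sequence_def)
  have le2: "card s \<le> 2" if "s \<in> segments V E" for s
  proof -
    let ?xs = "sorted_list_of_multiset (image_mset card (mset_set (segments V E)))"
    have ls: "ls = rev ?xs" using seq by (simp add: segment_sequence_def)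
    then have "?xs \<noteq> []" using ne by auto
    then have "ls ! 0 = last ?xs" unfolding ls by (simp add: hd_rev flip: hd_conv_nth)
    moreover have "card s \<in> set ?xs" using that set_ls ls by auto
    then have "card s \<le> last ?xs" by (intro sorted_le_last) auto
    ultimately show ?thesis using short by simp
  qed
  \<comment> \<open>Since \<open>ls\<close> is nonempty there is a segment, and its end is the
    vertex of degree other than two that \<open>long_segment_exists\<close> asks for.\<close>
  obtain s where "s \<in> segments V E" using set_ls ne by fastforce
  then obtain ws where ws: "is_segment V E ws" by (auto simp: segments_def)
  then have "hd ws \<in> set ws" by (auto simp: is_segment_def intro!: hd_in_set)
  then have h: "hd ws \<in> V" "degree E (hd ws) \<noteq> 2" using ws by (auto simp: is_segment_def)
  show indep: "\<not> adj E u v" if deg: "degree E u = 2" "degree E v = 2" for u v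
  proof
    assume uv: "adj E u v"
    obtain s where "s \<in> segments V E" "card s \<ge> 3"
      using long_segment_exists[OF G conn h deg uv] by blast
    then show False using le2 by fastforce
  qed
  define E0 where "E0 = {e \<in> E. \<forall>v\<in>e. degree E v \<noteq> 2}"
  let ?S1 = "(\<lambda>e. {e}) ` E0" and ?S2 = "(\<lambda>d. {e \<in> E. d \<in> e}) ` D"
  have segs: "segments V E = ?S1 \<union> ?S2"
    unfolding E0_def D_def by (rule segments_eq[OF G indep])
  have finD: "finite D" using finV by (simp add: D_def)
  have finE0: "finite E0" using finE by (simp add: E0_def)
  have card_star: "card {e \<in> E. d \<in> e} = 2" if "d \<in> D" for d
    using that card_incident_edges[OF G] by (simp add: D_def)
  have disj: "{e \<in> E. d \<in> e} \<inter> {e \<in> E. d' \<in> e} = {}" if "d \<in> D" "d' \<in> D" "d \<noteq> d'" for d d'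
  proof (rule ccontr)
    assume "{e \<in> E. d \<in> e} \<inter> {e \<in> E. d' \<in> e} \<noteq> {}"
    then obtain e where e: "e \<in> E" "d \<in> e" "d' \<in> e" by blast
    then obtain a b where "e = {a, b}" using G unfolding simple_graph_def by blast
    then have "e = {d, d'}" using e that(3) by auto
    then show False using e indep[of d d'] that by (auto simp: adj_def D_def)
  qed
  have inj: "inj_on (\<lambda>d. {e \<in> E. d \<in> e}) D"
  proof (rule inj_onI, rule ccontr)
    fix d d' assume *: "d \<in> D" "d' \<in> D" "{e \<in> E. d \<in> e} = {e \<in> E. d' \<in> e}" "d \<noteq> d'"
    have "{e \<in> E. d' \<in> e} = {}" using disj[OF *(1,2,4)] unfolding *(3) by simp
    then show False using card_star[OF *(2)] by (metis card.empty zero_neq_numeral)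
  qed
  have c1: "card ?S1 = card E0" by (rule card_image) (auto simp: inj_on_def)
  have c2: "card ?S2 = card D" by (rule card_image[OF inj])
  have "E = E0 \<union> (\<Union>d\<in>D. {e \<in> E. d \<in> e})"
    using sub by (auto simp: E0_def D_def)
  also have "card \<dots> = card E0 + card (\<Union>d\<in>D. {e \<in> E. d \<in> e})"
    by (rule card_Un_disjoint) (use finE finD finE0 in \<open>auto simp: E0_def D_def\<close>)
  also have "card (\<Union>d\<in>D. {e \<in> E. d \<in> e}) = (\<Sum>d\<in>D. card {e \<in> E. d \<in> e})"
    by (rule card_UN_disjoint) (use finE finD disj in auto)
  also have "\<dots> = 2 * card D" using card_star by simp
  finally have "card V = card E0 + 2 * card D" using unicyclic_card_edges[OF uni] by simp
  moreover have "card V = card (V - D) + card D"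
    using card_Diff_subset[OF finD, of V] card_mono[OF finV, of D] by (simp add: D_def)
  ultimately have E0: "card (V - D) = card E0 + card D" by simp
  then show "card D \<le> card (V - D)" by simp
  have d12: "?S1 \<inter> ?S2 = {}"
  proof (rule ccontr)
    assume "?S1 \<inter> ?S2 \<noteq> {}"
    then obtain e d where "{e} = {e \<in> E. d \<in> e}" "d \<in> D" by auto
    then have "card {e} = 2" using card_star[of d] by metis
    then show False by simp
  qed
  have "image_mset card (mset_set (segments V E)) = image_mset card (mset_set ?S1) + image_mset card (mset_set ?S2)"
    unfolding segs by (subst mset_set_Union) (use finE0 finD d12 in auto)
  also have "image_mset card (mset_set ?S1) = image_mset (\<lambda>_. 1) (mset_set ?S1)"
    by (rule image_mset_cong) (use finE0 in auto)
  also have "\<dots> = replicate_mset (card E0) 1"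
    unfolding image_mset_const_eq using c1 by simp
  also have "image_mset card (mset_set ?S2) = image_mset (\<lambda>_. 2) (mset_set ?S2)"
    by (rule image_mset_cong) (use finD card_star in auto)
  also have "\<dots> = replicate_mset (card D) 2"
    unfolding image_mset_const_eq using c2 by simp
  also have "replicate_mset (card E0) 1 + replicate_mset (card D) 2
      = mset (replicate (card E0) 1 @ replicate (card D) (2::nat))" by simp
  finally have "ls = rev (sort (replicate (card E0) 1 @ replicate (card D) 2))"
    using seq by (simp add: segment_sequence_def del: mset_append mset_replicate)
  also have "sort (replicate (card E0) 1 @ replicate (card D) (2::nat)) = replicate (card E0) 1 @ replicate (card D) 2"
    by (rule sorted_sort_id) (auto simp: sorted_append)
  finally show "ls = replicate (card D) 2 @ replicate (card (V - D) - card D) 1"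
    using E0 by simp
qed

subsection \<open>The extremal values\<close>

text \<open>There are \<open>m\<close> segments, \<open>k\<close> of which have length two.\<close>

definition extremal :: "nat \<Rightarrow> nat \<Rightarrow> nat" where
  "extremal m k = (if k = 0 then 2 ^ (m - 2) + 4 else if k = 1 then 5 * 2 ^ (m - 3) + 2
     else if k = 2 then 9 * 2 ^ (m - 3) + 3
     else 14 * 3 ^ (k - 3) * 2 ^ (m - k) + 5 * 2 ^ (k - 3))"

text \<open>Equality holds for a single subdivided ray; a single plain ray already does
  better.\<close>

lemma star_ratio:
  assumes "1 \<le> p + q"
  shows "3 * (2::nat) ^ q \<le> 2 * (2 ^ p * 3 ^ q)"
proof (cases q)
  case 0
  then obtain p' where "p = Suc p'" using assms by (cases p) auto
  moreover have "(1::nat) \<le> 2 ^ p'" by simp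
  ultimately have "3 \<le> 4 * (2::nat) ^ p'" by linarith
  then show ?thesis using 0 \<open>p = Suc p'\<close> by simp
next
  case (Suc q')
  then show ?thesis using star_weight_le[of q' p] by simp
qed

lemma star_ratio_plain: "1 \<le> p \<Longrightarrow> 2 \<le> (2::nat) ^ p"
  by (cases p) auto

text \<open>The digits in the names are the lengths of the cycle segments that are cut. For a fixed number
  of segments of each length, \<open>a1 * a2\<close> and \<open>b1 * b2\<close> are constant, and
  \<open>(2 * a1 - 3 * b1) * (2 * a2 - 3 * b2) \<ge> 0\<close> bounds \<open>a1 * b2 + b1 * a2\<close>.\<close>

lemma extremal_22:
  fixes p1 q1 p2 q2 :: nat
  assumes "1 \<le> p1 + q1" "1 \<le> p2 + q2" "k = q1 + q2 + 2" "m = p1 + q1 + p2 + q2 + 2"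
  defines "a1 \<equiv> 2 ^ p1 * 3 ^ q1" and "b1 \<equiv> 2 ^ q1" and "a2 \<equiv> 2 ^ p2 * 3 ^ q2" and "b2 \<equiv> 2 ^ q2"
  shows "a1 * (4 * a2 + b2) + b1 * (a2 + b2) \<le> extremal m k"
proof (cases "q1 + q2")
  case 0
  then have "q1 = 0" "q2 = 0" "p1 \<ge> 1" "p2 \<ge> 1" using assms by auto
  \<comment> \<open>Without subdivided rays the ratio 2/3 is too weak; as
    \<open>b1 = b2 = 1\<close>, the inequality \<open>(a1 - 2) * (a2 - 2) \<ge> 0\<close> takes its
    place.\<close>
  then have "a1 * 2 + 2 * a2 \<le> a1 * a2 + 2 * 2" "b1 = 1" "b2 = 1"
    using cross_products_le[of 2 a1 2 a2] star_ratio_plain by (auto simp: a1_def a2_def b1_def b2_def)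
  moreover have "a1 * a2 = 2 * 2 ^ (m - 3)" "k = 2"
  proof -
    have "p1 + p2 = Suc (m - 3)" using \<open>q1 = 0\<close> \<open>q2 = 0\<close> \<open>p1 \<ge> 1\<close> assms(4) by simp
    then have "2 ^ (p1 + p2) = 2 * (2::nat) ^ (m - 3)" by (metis power_Suc)
    then show "a1 * a2 = 2 * 2 ^ (m - 3)" using \<open>q1 = 0\<close> \<open>q2 = 0\<close> by (simp add: a1_def a2_def power_add)
  qed (use 0 assms in simp)
  ultimately show ?thesis by (simp add: extremal_def algebra_simps)
next
  case (Suc j)
  define X :: nat where "X = 3 ^ j * 2 ^ (p1 + p2)"
  define Y :: nat where "Y = 2 ^ j"
  have k: "k = j + 3" "m - k = p1 + p2" using assms Suc by auto
  have "a1 * a2 = 2 ^ (p1 + p2) * 3 ^ (q1 + q2)" "b1 * b2 = 2 ^ (q1 + q2)"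
    by (simp_all add: a1_def a2_def b1_def b2_def power_add)
  then have A: "a1 * a2 = 3 * X" "b1 * b2 = 2 * Y" unfolding Suc X_def Y_def by simp_all
  have "(2 * a1) * (3 * b2) + (3 * b1) * (2 * a2) \<le> (2 * a1) * (2 * a2) + (3 * b1) * (3 * b2)"
    by (rule cross_products_le) (use star_ratio[OF assms(1)] star_ratio[OF assms(2)] in
        \<open>simp_all add: a1_def a2_def b1_def b2_def\<close>)
  then have "6 * (a1 * b2) + 6 * (b1 * a2) \<le> 4 * (3 * X) + 9 * (2 * Y)" using A by simp
  then have "a1 * (4 * a2 + b2) + b1 * (a2 + b2) \<le> 14 * X + 5 * Y"
    using A by (simp add: algebra_simps)
  then show ?thesis using k by (simp add: extremal_def X_def Y_def mult.assoc)
qed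

lemma extremal_21:
  fixes p1 q1 p2 q2 :: nat
  assumes "1 \<le> p1 + q1" "1 \<le> p2 + q2" "k = q1 + q2 + 1" "m = p1 + q1 + p2 + q2 + 2"
  defines "a1 \<equiv> 2 ^ p1 * 3 ^ q1" and "b1 \<equiv> 2 ^ q1" and "a2 \<equiv> 2 ^ p2 * 3 ^ q2" and "b2 \<equiv> 2 ^ q2"
  shows "a1 * (2 * a2 + b2) + b1 * a2 \<le> extremal m k"
proof -
  have prods: "a1 * a2 = 2 ^ (p1 + p2) * 3 ^ (q1 + q2)" "b1 * b2 = 2 ^ (q1 + q2)"
    by (simp_all add: a1_def a2_def b1_def b2_def power_add)
  have "(2 * a1) * (3 * b2) + (3 * b1) * (2 * a2) \<le> (2 * a1) * (2 * a2) + (3 * b1) * (3 * b2)"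
    by (rule cross_products_le) (use star_ratio[OF assms(1)] star_ratio[OF assms(2)] in
        \<open>simp_all add: a1_def a2_def b1_def b2_def\<close>)
  then have cross: "6 * (a1 * b2) + 6 * (b1 * a2) \<le> 4 * (a1 * a2) + 9 * (b1 * b2)" by simp
  consider "q1 + q2 = 0" | "q1 + q2 = 1" | j where "q1 + q2 = Suc (Suc j)"
    by (metis One_nat_def not0_implies_Suc)
  then show ?thesis
  proof cases
    case 1
    then have "q1 = 0" "q2 = 0" "p1 \<ge> 1" "p2 \<ge> 1" using assms by auto
    then have "a1 * 2 + 2 * a2 \<le> a1 * a2 + 2 * 2" "b1 = 1" "b2 = 1"
      using cross_products_le[of 2 a1 2 a2] star_ratio_plain by (auto simp: a1_def a2_def b1_def b2_def)
    moreover have "a1 * a2 = 2 * 2 ^ (m - 3)"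
    proof -
      have "p1 + p2 = Suc (m - 3)" using \<open>q1 = 0\<close> \<open>q2 = 0\<close> \<open>p1 \<ge> 1\<close> assms(4) by simp
      then have "2 ^ (p1 + p2) = 2 * (2::nat) ^ (m - 3)" by (metis power_Suc)
      then show ?thesis using \<open>q1 = 0\<close> \<open>q2 = 0\<close> by (simp add: a1_def a2_def power_add)
    qed
    moreover have "k = 1" using 1 assms by simp
    ultimately show ?thesis by (simp add: extremal_def algebra_simps)
  next
    case 2
    then have "m - 3 = p1 + p2" "k = 2" using assms by auto
    then show ?thesis using cross prods 2 by (simp add: extremal_def algebra_simps)
  next
    case 3
    define X :: nat where "X = 3 ^ j * 2 ^ (p1 + p2)"
    define Y :: nat where "Y = 2 ^ j"
    have k: "k = j + 3" "m - k = Suc (p1 + p2)" using assms 3 by auto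
    have A: "a1 * a2 = 9 * X" "b1 * b2 = 4 * Y" unfolding prods 3 X_def Y_def by simp_all
    \<comment> \<open>The estimate obtained is \<open>24 * X + 6 * Y\<close>; this inequality brings
      it below \<open>28 * X + 5 * Y\<close>.\<close>
    have "Y \<le> X" using star_weight_le[of j "p1 + p2"] by (simp add: X_def Y_def mult.commute)
    then have "a1 * (2 * a2 + b2) + b1 * a2 \<le> 28 * X + 5 * Y"
      using A cross by (simp add: algebra_simps)
    then show ?thesis using k by (simp add: extremal_def X_def Y_def mult.assoc)
  qed
qed

text \<open>For \<open>k = 1\<close> the inequality fails: one star consisting of a single
  subdivided ray and one of plain rays give \<open>5 * 2 ^ (m - 3) + 3\<close>, one more than the
  extremal value. This is why small \<open>k\<close> requires three pieces.\<close>

lemma extremal_11: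
  fixes p1 q1 p2 q2 :: nat
  assumes "1 \<le> p1 + q1" "1 \<le> p2 + q2" "k = q1 + q2" "2 \<le> k" "m = p1 + q1 + p2 + q2 + 2"
  defines "a1 \<equiv> 2 ^ p1 * 3 ^ q1" and "b1 \<equiv> 2 ^ q1" and "a2 \<equiv> 2 ^ p2 * 3 ^ q2" and "b2 \<equiv> 2 ^ q2"
  shows "a1 * (a2 + b2) + b1 * a2 \<le> extremal m k"
proof -
  have prods: "a1 * a2 = 2 ^ (p1 + p2) * 3 ^ (q1 + q2)" "b1 * b2 = 2 ^ (q1 + q2)"
    by (simp_all add: a1_def a2_def b1_def b2_def power_add)
  have "(2 * a1) * (3 * b2) + (3 * b1) * (2 * a2) \<le> (2 * a1) * (2 * a2) + (3 * b1) * (3 * b2)"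
    by (rule cross_products_le) (use star_ratio[OF assms(1)] star_ratio[OF assms(2)] in
        \<open>simp_all add: a1_def a2_def b1_def b2_def\<close>)
  then have cross: "6 * (a1 * b2) + 6 * (b1 * a2) \<le> 4 * (a1 * a2) + 9 * (b1 * b2)" by simp
  consider "q1 + q2 = 2" | j where "q1 + q2 = j + 3"
    using assms(3,4) by (metis add.commute le_neq_implies_less less_eqE numeral_2_eq_2 numeral_3_eq_3 Suc_leI)
  then show ?thesis
  proof cases
    case 1
    define X :: nat where "X = 2 ^ (p1 + p2)"
    have "m - 3 = Suc (p1 + p2)" "k = 2" using assms 1 by auto
    moreover have "a1 * a2 = 9 * X" "b1 * b2 = 4" unfolding prods 1 X_def by simp_all
    moreover have "X \<ge> 1" by (simp add: X_def)
    ultimately have "a1 * (a2 + b2) + b1 * a2 \<le> 18 * X + 3" using cross by (simp add: algebra_simps)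
    then show ?thesis using \<open>m - 3 = _\<close> \<open>k = 2\<close> by (simp add: extremal_def X_def)
  next
    case 2
    define X :: nat where "X = 3 ^ j * 2 ^ (p1 + p2)"
    define Y :: nat where "Y = 2 ^ j"
    have k: "k = j + 3" "m - k = Suc (Suc (p1 + p2))" using assms 2 by auto
    have A: "a1 * a2 = 27 * X" "b1 * b2 = 8 * Y" unfolding prods 2 X_def Y_def by (simp_all add: power_add)
    have "Y \<le> X" using star_weight_le[of j "p1 + p2"] by (simp add: X_def Y_def mult.commute)
    then have "a1 * (a2 + b2) + b1 * a2 \<le> 56 * X + 5 * Y"
      using A cross by (simp add: algebra_simps)
    then show ?thesis using k by (simp add: extremal_def X_def Y_def mult.assoc)
  qed
qed

text \<open>The left side counts the independent sets of a triangle with a star centred at each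
  corner: at most one centre is chosen.\<close>

lemma extremal_111:
  fixes p1 q1 p2 q2 p3 q3 :: nat
  assumes "1 \<le> p1 + q1" "1 \<le> p2 + q2" "1 \<le> p3 + q3" "k = q1 + q2 + q3" "k \<le> 1"
    "m = p1 + q1 + p2 + q2 + p3 + q3 + 3"
  defines "a1 \<equiv> 2 ^ p1 * 3 ^ q1" and "b1 \<equiv> 2 ^ q1" and "a2 \<equiv> 2 ^ p2 * 3 ^ q2" and "b2 \<equiv> 2 ^ q2"
    and "a3 \<equiv> 2 ^ p3 * 3 ^ q3" and "b3 \<equiv> 2 ^ q3"
  shows "a1 * (a2 * (a3 + b3) + b2 * a3) + b1 * (a2 * a3) \<le> extremal m k"
proof (cases "k = 0")
  case True
  then have q: "q1 = 0" "q2 = 0" "q3 = 0" "p1 \<ge> 1" "p2 \<ge> 1" "p3 \<ge> 1" using assms by auto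
  then obtain x y z where xyz: "p1 = Suc x" "p2 = Suc y" "p3 = Suc z" by (metis Suc_le_D One_nat_def)
  \<comment> \<open>With \<open>a1 = 2 * (1 + r)\<close> and likewise for the others, constant and
    linear terms cancel, and the right side exceeds the left by
    \<open>4 * (r * s + r * t + s * t) + 8 * r * s * t\<close>.\<close>
  obtain r s t :: nat where rst: "2 ^ x = 1 + r" "2 ^ y = 1 + s" "2 ^ z = 1 + t"
    by (metis le_Suc_ex one_le_numeral one_le_power)
  have "m - 2 = 4 + (x + y + z)" using assms(6) q xyz by simp
  then have "2 ^ (m - 2) = 16 * ((1 + r) * (1 + s) * (1 + t))"
    by (simp add: power_add rst)
  then show ?thesis
    using True q xyz rst by (simp add: extremal_def a1_def a2_def a3_def b1_def b2_def b3_def algebra_simps)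
next
  case False
  then have k: "k = 1" using assms(5) by linarith
  define X :: nat where "X = 2 ^ (p1 + p2 + p3)"
  have "a1 * a2 * a3 = 2 ^ (p1 + p2 + p3) * 3 ^ (q1 + q2 + q3)"
    by (simp add: a1_def a2_def a3_def power_add)
  also have "q1 + q2 + q3 = 1" using assms(4) k by simp
  finally have A: "a1 * a2 * a3 = 3 * X" by (simp add: X_def)
  have r: "3 * b1 \<le> 2 * a1" "3 * b2 \<le> 2 * a2" "3 * b3 \<le> 2 * a3"
    using star_ratio[OF assms(1)] star_ratio[OF assms(2)] star_ratio[OF assms(3)]
    by (simp_all add: a1_def a2_def a3_def b1_def b2_def b3_def)
  define T where "T = a1 * (a2 * a3)"
  \<comment> \<open>Each choice of a centre contributes at most two thirds of \<open>T\<close>, for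
    a total of \<open>3 * T = 9 * X\<close>, below the extremal \<open>10 * X + 2\<close>.\<close>
  have "3 * (b1 * (a2 * a3)) \<le> 2 * T" "3 * (b2 * (a1 * a3)) \<le> 2 * T" "3 * (b3 * (a1 * a2)) \<le> 2 * T"
    using mult_right_mono[OF r(1), of "a2 * a3"] mult_right_mono[OF r(2), of "a1 * a3"]
      mult_right_mono[OF r(3), of "a1 * a2"] unfolding T_def by (simp_all only: mult_ac zero_le)
  moreover have "a1 * (a2 * (a3 + b3) + b2 * a3) + b1 * (a2 * a3)
      = T + b1 * (a2 * a3) + b2 * (a1 * a3) + b3 * (a1 * a2)"
    unfolding T_def by (simp add: algebra_simps)
  ultimately have "a1 * (a2 * (a3 + b3) + b2 * a3) + b1 * (a2 * a3) \<le> 3 * T" by linarith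
  moreover have "m - 3 = Suc (p1 + p2 + p3)" using assms k by simp
  ultimately show ?thesis using k A by (simp add: extremal_def X_def T_def mult.assoc)
qed

subsection \<open>The upper bound\<close>

lemma sigma_cut_vertex_le:
  assumes "finite X" "finite Y" "X \<inter> Y = {}" "u \<in> X" "{u} \<notin> E"
    and "\<And>a b. a \<in> X \<Longrightarrow> b \<in> Y \<Longrightarrow> {a, b} \<in> E \<Longrightarrow> a = u"
    and "sigma X E \<le> a + b" "sigma (X - {u}) E \<le> a"
  shows "sigma (X \<union> Y) E \<le> a * sigma Y E + b * sigma (Y - {w. {u, w} \<in> E}) E"
proof -
  have "sigma (X \<union> Y) E = sigma (X - {u}) E * sigma Y E
      + sigma (X - {u} - {w. {u, w} \<in> E}) E * sigma (Y - {w. {u, w} \<in> E}) E"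
    by (rule sigma_cut_vertex) (use assms(1-6) in blast)+
  also have "\<dots> \<le> a * sigma Y E + b * sigma (Y - {w. {u, w} \<in> E}) E"
  proof (rule weighted_le)
    show "sigma (X - {u}) E + sigma (X - {u} - {w. {u, w} \<in> E}) E \<le> a + b"
      using sigma_delete[OF assms(1,4,5)] assms(7) by simp
    show "sigma (Y - {w. {u, w} \<in> E}) E \<le> sigma Y E"
      by (rule sigma_mono[OF assms(2)]) auto
  qed fact
  finally show ?thesis .
qed

text \<open>A marked vertex brings two unmarked neighbours, so any second vertex forces a second
  unmarked one. This yields the ray that \<open>star_ratio\<close> needs.\<close>

lemma subdividing_card_ge_2:
  assumes "subdividing E P D" "finite P" "v \<in> P - D" "z \<in> P" "z \<noteq> v"
  shows "2 \<le> card (P - D)"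
proof -
  obtain y where "y \<in> P - D" "y \<noteq> v"
  proof (cases "z \<in> D")
    case True
    then show ?thesis using that assms(1) unfolding subdividing_def by metis
  qed (use that assms in blast)
  then have "{v, y} \<subseteq> P - D" "card {v, y} = 2" using assms(3) by auto
  then show ?thesis using card_mono[of "P - D" "{v, y}"] assms(2) by simp
qed

lemma walk_stays:
  assumes "(adj F)\<^sup>*\<^sup>* a b" "a \<in> Y" "\<And>y z. y \<in> Y \<Longrightarrow> {y, z} \<in> F \<Longrightarrow> z \<in> Y"
  shows "b \<in> Y"
  using assms by (induction rule: rtranclp_induct) (auto simp: adj_def)

section \<open>Cutting the cycle of a graph with short segments\<close>

locale short_unicyclic =
  fixes V :: "'a set" and E :: "'a set set" and D :: "'a set"
  assumes uni: "unicyclic V E"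
    and D: "D = {v \<in> V. degree E v = 2}"
    and indep: "\<And>u v. u \<in> D \<Longrightarrow> v \<in> D \<Longrightarrow> {u, v} \<notin> E"
begin

text \<open>These are the edges of the cycle; the formulation by reachability avoids handling the
  cycle as a list.\<close>

abbreviation "nonbridge u v \<equiv> {u, v} \<in> E \<and> (adj (E - {{u, v}}))\<^sup>*\<^sup>* u v"

lemma simple: "simple_graph V E"
  using uni by (simp add: unicyclic_def)

lemmas edge = simple_graph_edgeD[OF simple]

lemma finV: "finite V"
  using simple by (simp add: simple_graph_def)

lemma no_loop: "{v} \<notin> E"
  using edge(1)[of v v] by auto

lemma nonbridge_commute: "nonbridge u v \<Longrightarrow> nonbridge v u"
  using adj_rtranclp_commute by (metis insert_commute)

lemma subdividing_V: "subdividing E V D"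
  unfolding subdividing_def
proof (intro conjI ballI)
  fix d assume d: "d \<in> D"
  then have "card {w. {d, w} \<in> E} = 2" by (simp add: D degree_def)
  then obtain y z where yz: "{w. {d, w} \<in> E} = {y, z}" "y \<noteq> z" by (meson card_2_iff)
  then have "{d, y} \<in> E" "{d, z} \<in> E" by auto
  then have "y \<in> V - D" "z \<in> V - D" using edge(3) indep d by blast+
  moreover have "{w \<in> V. {d, w} \<in> E} = {y, z}" using yz edge(3) by blast
  ultimately show "\<exists>y\<in>V - D. \<exists>z\<in>V - D. y \<noteq> z \<and> {w \<in> V. {d, w} \<in> E} = {y, z}"
    using yz(2) by blast
qed (auto simp: D)

lemma other_neighbour:
  assumes "d \<in> D" "{d, u} \<in> E"
  obtains v where "v \<in> V - D" "v \<noteq> u" "{w. {d, w} \<in> E} = {u, v}"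
proof -
  obtain y z where yz: "y \<in> V - D" "z \<in> V - D" "y \<noteq> z" "{w \<in> V. {d, w} \<in> E} = {y, z}"
    using subdividing_V assms(1) unfolding subdividing_def by blast
  then have N: "{w. {d, w} \<in> E} = {y, z}" using edge(3) by blast
  then consider "u = y" | "u = z" using assms(2) by blast
  then show ?thesis
  proof cases
    case 1
    then show ?thesis using that[of z] yz N by simp
  next
    case 2
    then show ?thesis using that[of y] yz N by (simp add: insert_commute)
  qed
qed

lemma third_neighbour:
  assumes "v \<in> V - D" "{v, a} \<in> E" "{v, b} \<in> E" "a \<noteq> b"
  obtains n where "{v, n} \<in> E" "n \<noteq> a" "n \<noteq> b" "n \<noteq> v"
proof -
  have "card {w. {v, w} \<in> E} \<noteq> 2" using assms(1) by (simp add: D degree_def)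
  then have "{w. {v, w} \<in> E} \<noteq> {a, b}" using assms(4) by auto
  then show ?thesis using that assms(2,3) edge(1) by blast
qed

text \<open>Deleting the edge to \<open>x\<close> leaves a tree, in which the path from
  \<open>u\<close> to \<open>x\<close> starts with \<open>x'\<close>. The tree is split at the edge
  to \<open>x'\<close>, and the rest of the path keeps \<open>x\<close> on that side.\<close>

lemma cycle_cut:
  assumes "nonbridge u x"
  obtains X Y x' where "X \<union> Y = V" "X \<inter> Y = {}" "u \<in> X" "x \<in> Y" "x' \<in> Y" "x \<noteq> x'"
    "nonbridge u x'" "tree_on E X" "tree_on E Y"
    "\<And>a b. a \<in> X \<Longrightarrow> b \<in> Y \<Longrightarrow> {a, b} \<in> E \<Longrightarrow> a = u \<and> (b = x \<or> b = x')"
proof -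
  let ?F = "E - {{u, x}}"
  have ux: "{u, x} \<in> E" "(adj ?F)\<^sup>*\<^sup>* u x" using assms by auto
  have tree: "tree_on ?F V" by (rule unicyclic_remove_nonbridge[OF uni ux])
  obtain x' where x': "{u, x'} \<in> ?F" "(adj (?F - {{u, x'}}))\<^sup>*\<^sup>* x' x"
    using reachable_first_step[OF ux(2)] edge(1)[OF ux(1)] by blast
  have uV: "u \<in> V" "x' \<in> V" using x'(1) edge by blast+
  obtain X Y where s: "X \<union> Y = V" "X \<inter> Y = {}" "u \<in> X" "x' \<in> Y" "tree_on ?F X" "tree_on ?F Y"
    and cross: "\<And>a b. a \<in> X \<Longrightarrow> b \<in> Y \<Longrightarrow> {a, b} \<in> ?F \<Longrightarrow> a = u \<and> b = x'"
    using tree_on_split[OF tree uV x'(1)] by blast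
  have xY: "x \<in> Y"
  proof (rule walk_stays[OF x'(2) s(4)])
    fix y z assume y: "y \<in> Y" and yz: "{y, z} \<in> ?F - {{u, x'}}"
    then have "z \<in> V" "{z, y} \<in> ?F" using edge(3) by (auto simp: insert_commute)
    moreover have "\<not> (z = u \<and> y = x')" using yz by (auto simp: insert_commute)
    ultimately show "z \<in> Y" using cross[of z y] y s(1) by blast
  qed
  have "E \<inter> Pow X = ?F \<inter> Pow X" "E \<inter> Pow Y = ?F \<inter> Pow Y" using xY s(2,3) by blast+
  then have trees: "tree_on E X" "tree_on E Y" using s(5,6) tree_on_cong by metis+
  have neq: "x \<noteq> x'" using x'(1) by auto
  have nb: "nonbridge u x'"
  proof
    have "adj (E - {{u, x'}}) u x" using ux(1) neq by (auto simp: adj_def doubleton_eq_iff)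
    moreover have "(adj (E - {{u, x'}}))\<^sup>*\<^sup>* x x'"
      using adj_rtranclp_mono[OF adj_rtranclp_commute[OF x'(2)], of "E - {{u, x'}}"] by blast
    ultimately show "(adj (E - {{u, x'}}))\<^sup>*\<^sup>* u x'" by (rule converse_rtranclp_into_rtranclp)
  qed (use x'(1) in blast)
  have cr: "a = u \<and> (b = x \<or> b = x')" if "a \<in> X" "b \<in> Y" "{a, b} \<in> E" for a b
  proof (cases "{a, b} = {u, x}")
    case True
    then show ?thesis using that s(2) xY s(3) by (auto simp: doubleton_eq_iff)
  next
    case False
    then show ?thesis using cross that by blast
  qed
  show ?thesis using that[OF s(1-3) xY s(4) neq nb trees cr] by blast
qed

end

text \<open>Here \<open>x\<close> and \<open>x'\<close> are the two cycle neighbours of the cycle vertex \<open>u\<close>, and the cycle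
  edges at \<open>u\<close> are cut.\<close>

locale cut_unicyclic = short_unicyclic +
  fixes u x x' :: 'a and X Y :: "'a set"
  assumes cover: "X \<union> Y = V" and disj: "X \<inter> Y = {}" and uX: "u \<in> X" and xY: "x \<in> Y" "x' \<in> Y"
    and neq: "x \<noteq> x'" and ux: "{u, x} \<in> E" "{u, x'} \<in> E" and uD: "u \<notin> D"
    and tree: "tree_on E X" "tree_on E Y"
    and cross: "\<And>a b. a \<in> X \<Longrightarrow> b \<in> Y \<Longrightarrow> {a, b} \<in> E \<Longrightarrow> a = u \<and> (b = x \<or> b = x')"
begin

lemma finite_pieces: "finite X" "finite Y"
  using finV cover by (metis finite_Un)+

lemma pieces_subset: "X \<subseteq> V" "Y \<subseteq> V"
  using cover by auto

lemma uY: "u \<notin> Y"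
  using uX disj by blast

lemma cross': "a \<in> Y \<Longrightarrow> b \<in> X \<Longrightarrow> {a, b} \<in> E \<Longrightarrow> b = u \<and> (a = x \<or> a = x')"
  using cross[of b a] by (simp add: insert_commute)

lemma card_split: "card (V - D) = card (X - D) + card (Y - D)"
    "card D = card (D \<inter> X) + card (D \<inter> Y)"
proof -
  have "V - D = (X - D) \<union> (Y - D)" "D = (D \<inter> X) \<union> (D \<inter> Y)" using cover D by auto
  moreover have "card ((X - D) \<union> (Y - D)) = card (X - D) + card (Y - D)"
    by (rule card_Un_disjoint) (use finite_pieces disj in auto)
  moreover have "card ((D \<inter> X) \<union> (D \<inter> Y)) = card (D \<inter> X) + card (D \<inter> Y)"
    by (rule card_Un_disjoint) (use finite_pieces disj in auto)
  ultimately show "card (V - D) = card (X - D) + card (Y - D)" "card D = card (D \<inter> X) + card (D \<inter> Y)"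
    by metis+
qed

text \<open>In \<open>Y\<close> the vertices \<open>x\<close> and \<open>x'\<close> lose their
  neighbour \<open>u\<close>, so they cannot keep their marks; a degree-two one turns into the end
  of a plain ray.\<close>

lemma subdividing_Y: "subdividing E Y (D \<inter> Y - {x, x'})"
proof (rule subdividing_restrict[OF subdividing_V])
  fix d w assume "d \<in> D \<inter> Y - {x, x'}" "w \<in> V" "{d, w} \<in> E"
  then show "w \<in> Y" using cross'[of d w] cover by blast
qed (use pieces_subset in blast)+

text \<open>The piece at \<open>u\<close> is not a single vertex since \<open>u\<close> has degree at least three.\<close>

lemma bound_via_X:
  obtains p where "card (X - D) = Suc (p + card (D \<inter> X))" "1 \<le> p + card (D \<inter> X)"
    "sigma V E \<le> 2 ^ p * 3 ^ card (D \<inter> X) * sigma Y E + 2 ^ card (D \<inter> X) * sigma (Y - {x, x'}) E"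
proof -
  have sub: "subdividing E X (D \<inter> X)"
  proof (rule subdividing_restrict[OF subdividing_V])
    fix d w assume "d \<in> D \<inter> X" "w \<in> V" "{d, w} \<in> E"
    then show "w \<in> X" using cross[of d w] cover uD by blast
  qed (use pieces_subset in blast)+
  have XD: "X - D \<inter> X = X - D" by blast
  obtain p where p: "card (X - D) = Suc (p + card (D \<inter> X))"
    "sigma X E \<le> 2 ^ p * 3 ^ card (D \<inter> X) + 2 ^ card (D \<inter> X)"
    "sigma (X - {u}) E \<le> 2 ^ p * 3 ^ card (D \<inter> X)"
    using tree_star_bound[OF tree(1) sub, of u] uX uD XD by auto
  obtain n where n: "{u, n} \<in> E" "n \<noteq> x" "n \<noteq> x'" "n \<noteq> u"
    using third_neighbour[OF _ ux neq] uX uD pieces_subset by blast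
  have "n \<in> X" using cross[of u n] n uX cover edge(3)[OF n(1)] by blast
  then have "2 \<le> card (X - D)"
    using subdividing_card_ge_2[OF sub finite_pieces(1), of u n] uX uD n(4) XD by auto
  moreover have "sigma V E \<le> 2 ^ p * 3 ^ card (D \<inter> X) * sigma Y E
      + 2 ^ card (D \<inter> X) * sigma (Y - {w. {u, w} \<in> E}) E"
    using sigma_cut_vertex_le[OF finite_pieces disj uX no_loop _ p(2,3)] cross cover by metis
  moreover have "Y - {w. {u, w} \<in> E} = Y - {x, x'}" using cross[OF uX] ux by blast
  ultimately show ?thesis using that[of p] p(1) by simp
qed

text \<open>Both \<open>x\<close> and \<open>x'\<close> are leaves of \<open>Y\<close>. In the star
  for \<open>Y\<close> they amount to two plain rays, hence the factor 4; removing them gives the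
  tree \<open>?T\<close> that appears in the second summand.\<close>

lemma bound_22:
  assumes "x \<in> D" "x' \<in> D"
  shows "sigma V E \<le> extremal (card (V - D)) (card D)"
proof -
  let ?T = "Y - {x} - {x'}" and ?D' = "D \<inter> Y - {x, x'}"
  obtain v where v: "v \<in> V - D" "v \<noteq> u" "{w. {x, w} \<in> E} = {u, v}"
    using other_neighbour[OF assms(1), of u] ux by (metis insert_commute)
  obtain v' where v': "v' \<in> V - D" "v' \<noteq> u" "{w. {x', w} \<in> E} = {u, v'}"
    using other_neighbour[OF assms(2), of u] ux by (metis insert_commute)
  have xv: "{x, v} \<in> E" "{v, x} \<in> E" "{x', v'} \<in> E" "{v', x'} \<in> E"
    using v(3) v'(3) by (auto simp: insert_commute)
  have vY: "v \<in> Y" "v' \<in> Y" using cross'[OF xY(1)] cross'[OF xY(2)] v v' xv cover by blast+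
  have vT: "v \<in> ?T" "v' \<in> ?T" "v' \<in> Y - {x}" "x' \<in> Y - {x}" using vY v v' assms neq xY by auto
  have tree1: "tree_on E (Y - {x})"
  proof (rule tree_on_remove_leaf[OF tree(2) xY(1) vY(1) xv(2)])
    fix w assume "w \<in> Y" "{x, w} \<in> E"
    then have "w \<in> {u, v}" unfolding v(3)[symmetric] by simp
    then show "w = v" using \<open>w \<in> Y\<close> uY by auto
  qed
  have treeT: "tree_on E ?T"
  proof (rule tree_on_remove_leaf[OF tree1 vT(4,3) xv(4)])
    fix w assume "w \<in> Y - {x}" "{x', w} \<in> E"
    then have "w \<in> Y" by blast
    have "w \<in> {u, v'}" using \<open>{x', w} \<in> E\<close> unfolding v'(3)[symmetric] by simp
    then show "w = v'" using \<open>w \<in> Y\<close> uY by auto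
  qed
  have subT: "subdividing E ?T ?D'"
  proof (rule subdividing_restrict[OF subdividing_Y])
    fix d w assume d: "d \<in> ?D'" "w \<in> Y" "{d, w} \<in> E"
    have "{w, d} \<in> E" using d(3) by (simp add: insert_commute)
    moreover have "d \<notin> {u, v}" "d \<notin> {u, v'}" using d(1) v v' uD by auto
    ultimately have "w \<noteq> x" "w \<noteq> x'" unfolding v(3)[symmetric] v'(3)[symmetric] by auto
    then show "w \<in> ?T" using d by blast
  qed blast+
  have finT: "finite ?T" using finite_pieces by simp
  have TD: "?T - ?D' = Y - D" using assms by auto
  have "2 \<le> card (?T - ?D')"
  \<comment> \<open>Equality means a cycle of length four; the second unmarked vertex then comes
    from the third neighbour of \<open>v\<close>.\<close>
  proof (cases "v = v'")
    case True
    obtain n where n: "{v, n} \<in> E" "n \<noteq> x" "n \<noteq> x'" "n \<noteq> v"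
      using third_neighbour[OF v(1) xv(2) xv(4)[folded True] neq] by blast
    have "n \<in> Y" using cross'[OF vY(1) _ n(1)] cover edge(3)[OF n(1)] v(1) assms by blast
    then show ?thesis
      using subdividing_card_ge_2[OF subT finT, of v n] vT v(1) n by auto
  next
    case False
    then show ?thesis
      using subdividing_card_ge_2[OF subT finT, of v v'] vT v(1) by auto
  qed
  moreover obtain p2 where p2: "card (?T - ?D') = Suc (p2 + card ?D')"
    "sigma ?T E \<le> 2 ^ p2 * 3 ^ card ?D' + 2 ^ card ?D'"
    using tree_star_bound[OF treeT subT, of v] vT v(1) by blast
  moreover obtain pY where pY: "card (Y - ?D') = Suc (pY + card ?D')"
    "sigma Y E \<le> 2 ^ pY * 3 ^ card ?D' + 2 ^ card ?D'"
    using tree_star_bound[OF tree(2) subdividing_Y, of v] vY v(1) by blast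
  moreover obtain p1 where p1: "card (X - D) = Suc (p1 + card (D \<inter> X))" "1 \<le> p1 + card (D \<inter> X)"
    "sigma V E \<le> 2 ^ p1 * 3 ^ card (D \<inter> X) * sigma Y E + 2 ^ card (D \<inter> X) * sigma (Y - {x, x'}) E"
    by (rule bound_via_X)
  moreover have "card (Y - ?D') = card (?T - ?D') + 2"
  proof -
    have "Y - ?D' = insert x (insert x' (?T - ?D'))" using xY by auto
    then show ?thesis using finT neq by simp
  qed
  moreover have cD: "card (D \<inter> Y) = card ?D' + 2"
  proof -
    have "D \<inter> Y = insert x (insert x' ?D')" using xY assms by auto
    moreover have "card (insert x (insert x' ?D')) = card ?D' + 2" using finite_pieces neq by simp
    ultimately show ?thesis by simp
  qed
  ultimately have "pY = p2 + 2" "1 \<le> p2 + card ?D'" by auto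
  have "Y - {x, x'} = ?T" by blast
  then have "sigma V E \<le> 2 ^ p1 * 3 ^ card (D \<inter> X) * (4 * (2 ^ p2 * 3 ^ card ?D') + 2 ^ card ?D')
      + 2 ^ card (D \<inter> X) * (2 ^ p2 * 3 ^ card ?D' + 2 ^ card ?D')"
    using pY(2) p2(2) \<open>pY = p2 + 2\<close>
    by (intro order_trans[OF p1(3)] add_mono mult_left_mono) (auto simp: power_add)
  also have "\<dots> \<le> extremal (card (V - D)) (card D)"
    by (rule extremal_22)
      (use p1 p2 \<open>1 \<le> p2 + card ?D'\<close> cD card_split TD in simp_all)
  finally show ?thesis .
qed

text \<open>The leaf \<open>x\<close> adds one plain ray to the star for \<open>Y\<close>, hence the
  factor 2. Rooting \<open>?T\<close> at \<open>x'\<close> makes the second summand a count of sets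
  omitting the root.\<close>

lemma bound_21:
  assumes "x \<in> D" "x' \<notin> D"
  shows "sigma V E \<le> extremal (card (V - D)) (card D)"
proof -
  let ?T = "Y - {x}" and ?D' = "D \<inter> Y - {x, x'}"
  obtain v where v: "v \<in> V - D" "v \<noteq> u" "{w. {x, w} \<in> E} = {u, v}"
    using other_neighbour[OF assms(1), of u] ux by (metis insert_commute)
  have xv: "{x, v} \<in> E" "{v, x} \<in> E" using v(3) by (auto simp: insert_commute)
  have vY: "v \<in> Y" using cross'[OF xY(1)] v xv cover by blast
  have vT: "v \<in> ?T" "x' \<in> ?T" using vY v assms neq xY by auto
  have treeT: "tree_on E ?T"
  proof (rule tree_on_remove_leaf[OF tree(2) xY(1) vY(1) xv(2)])
    fix w assume "w \<in> Y" "{x, w} \<in> E"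
    then have "w \<in> {u, v}" unfolding v(3)[symmetric] by simp
    then show "w = v" using \<open>w \<in> Y\<close> uY by auto
  qed
  have subT: "subdividing E ?T ?D'"
  proof (rule subdividing_restrict[OF subdividing_Y])
    fix d w assume d: "d \<in> ?D'" "w \<in> Y" "{d, w} \<in> E"
    have "{w, d} \<in> E" using d(3) by (simp add: insert_commute)
    moreover have "d \<notin> {u, v}" using d(1) v uD by auto
    ultimately have "w \<noteq> x" unfolding v(3)[symmetric] by auto
    then show "w \<in> ?T" using d by blast
  qed blast+
  have finT: "finite ?T" using finite_pieces by simp
  have TD: "?T - ?D' = Y - D" using assms by auto
  have "2 \<le> card (?T - ?D')"
  \<comment> \<open>Equality means that the cycle is the triangle on \<open>u\<close>,
    \<open>x\<close> and \<open>x'\<close>.\<close>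
  proof (cases "v = x'")
    case True
    have "{v, u} \<in> E" using ux True by (simp add: insert_commute)
    moreover have "x \<noteq> u" using xY uX disj by blast
    ultimately obtain n where n: "{v, n} \<in> E" "n \<noteq> x" "n \<noteq> u" "n \<noteq> v"
      using third_neighbour[OF v(1) xv(2)] by metis
    have "n \<in> Y" using cross'[OF vY(1) _ n(1)] cover edge(3)[OF n(1)] n(3) by blast
    then show ?thesis
      using subdividing_card_ge_2[OF subT finT, of v n] vT v(1) n by auto
  next
    case False
    then show ?thesis
      using subdividing_card_ge_2[OF subT finT, of v x'] vT v(1) by auto
  qed
  moreover obtain p2 where p2: "card (?T - ?D') = Suc (p2 + card ?D')"
    "sigma (?T - {x'}) E \<le> 2 ^ p2 * 3 ^ card ?D'"
    using tree_star_bound[OF treeT subT, of x'] vT assms(2) by blast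
  moreover obtain pY where pY: "card (Y - ?D') = Suc (pY + card ?D')"
    "sigma Y E \<le> 2 ^ pY * 3 ^ card ?D' + 2 ^ card ?D'"
    using tree_star_bound[OF tree(2) subdividing_Y, of v] vY v(1) by blast
  moreover obtain p1 where p1: "card (X - D) = Suc (p1 + card (D \<inter> X))" "1 \<le> p1 + card (D \<inter> X)"
    "sigma V E \<le> 2 ^ p1 * 3 ^ card (D \<inter> X) * sigma Y E + 2 ^ card (D \<inter> X) * sigma (Y - {x, x'}) E"
    by (rule bound_via_X)
  moreover have "card (Y - ?D') = card (?T - ?D') + 1"
  proof -
    have "Y - ?D' = insert x (?T - ?D')" using xY by auto
    then show ?thesis using finT by simp
  qed
  moreover have cD: "card (D \<inter> Y) = card ?D' + 1"
  proof -
    have "D \<inter> Y = insert x ?D'" using xY assms by auto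
    moreover have "card (insert x ?D') = card ?D' + 1" using finite_pieces by simp
    ultimately show ?thesis by simp
  qed
  ultimately have "pY = p2 + 1" "1 \<le> p2 + card ?D'" by auto
  have "Y - {x, x'} = ?T - {x'}" by blast
  then have "sigma V E \<le> 2 ^ p1 * 3 ^ card (D \<inter> X) * (2 * (2 ^ p2 * 3 ^ card ?D') + 2 ^ card ?D')
      + 2 ^ card (D \<inter> X) * (2 ^ p2 * 3 ^ card ?D')"
    using pY(2) p2(2) \<open>pY = p2 + 1\<close>
    by (intro order_trans[OF p1(3)] add_mono mult_left_mono) auto
  also have "\<dots> \<le> extremal (card (V - D)) (card D)"
    by (rule extremal_21)
      (use p1 p2 \<open>1 \<le> p2 + card ?D'\<close> cD card_split TD in simp_all)
  finally show ?thesis .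
qed

text \<open>The star bound controls the removal of one root only, so \<open>Y - {x, x'}\<close> is
  enlarged to \<open>Y - {x}\<close>. The loss is affordable as soon as two segments have length
  two.\<close>

lemma bound_11:
  assumes "x \<notin> D" "x' \<notin> D" "2 \<le> card D"
  shows "sigma V E \<le> extremal (card (V - D)) (card D)"
proof -
  let ?D' = "D \<inter> Y"
  have sub: "subdividing E Y ?D'" using subdividing_Y assms by (simp add: Diff_insert_absorb Diff_triv)
  have YD: "Y - ?D' = Y - D" by auto
  have "2 \<le> card (Y - D)"
    using subdividing_card_ge_2[OF sub finite_pieces(2), of x x'] xY neq assms YD by auto
  moreover obtain p2 where p2: "card (Y - D) = Suc (p2 + card ?D')"
    "sigma Y E \<le> 2 ^ p2 * 3 ^ card ?D' + 2 ^ card ?D'" "sigma (Y - {x}) E \<le> 2 ^ p2 * 3 ^ card ?D'"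
    using tree_star_bound[OF tree(2) sub, of x] xY assms YD by auto
  moreover obtain p1 where p1: "card (X - D) = Suc (p1 + card (D \<inter> X))" "1 \<le> p1 + card (D \<inter> X)"
    "sigma V E \<le> 2 ^ p1 * 3 ^ card (D \<inter> X) * sigma Y E + 2 ^ card (D \<inter> X) * sigma (Y - {x, x'}) E"
    by (rule bound_via_X)
  ultimately have ge: "1 \<le> p2 + card ?D'" by auto
  have "sigma (Y - {x, x'}) E \<le> sigma (Y - {x}) E"
    by (rule sigma_mono) (use finite_pieces in auto)
  then have "sigma V E \<le> 2 ^ p1 * 3 ^ card (D \<inter> X) * (2 ^ p2 * 3 ^ card ?D' + 2 ^ card ?D')
      + 2 ^ card (D \<inter> X) * (2 ^ p2 * 3 ^ card ?D')"
    using p2(2,3) by (intro order_trans[OF p1(3)] add_mono mult_left_mono) auto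
  also have "\<dots> \<le> extremal (card (V - D)) (card D)"
    by (rule extremal_11) (use p1 p2 ge card_split assms(3) in simp_all)
  finally show ?thesis .
qed

text \<open>If no cycle edge is subdivided and \<open>k \<le> 1\<close>, the two-piece estimate is too weak, because it
  would be attained by a cycle of length two; so \<open>Y\<close> is cut once more along the cycle.\<close>

lemma bound_111:
  assumes nb: "\<And>d v. d \<in> D \<Longrightarrow> \<not> nonbridge v d" and "nonbridge u x" "nonbridge u x'" and k: "card D \<le> 1"
  shows "sigma V E \<le> extremal (card (V - D)) (card D)"
proof -
  have xD: "x \<notin> D" "x' \<notin> D" using assms by blast+
  have "(adj (E \<inter> Pow Y))\<^sup>*\<^sup>* x x'" using tree(2) xY unfolding tree_on_def by blast
  \<comment> \<open>\<open>w\<close> is the cycle vertex that follows \<open>x\<close> on the side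
    away from \<open>u\<close>; it may already be \<open>x'\<close>.\<close>
  then obtain w where w: "{x, w} \<in> E \<inter> Pow Y" "(adj (E \<inter> Pow Y - {{x, w}}))\<^sup>*\<^sup>* w x'"
    using reachable_first_step neq by metis
  have wY: "w \<in> Y" "{x, w} \<in> E" using w(1) by auto
  obtain Z W where s: "Z \<union> W = Y" "Z \<inter> W = {}" "x \<in> Z" "w \<in> W" "tree_on E Z" "tree_on E W"
    and cross2: "\<And>a b. a \<in> Z \<Longrightarrow> b \<in> W \<Longrightarrow> {a, b} \<in> E \<Longrightarrow> a = x \<and> b = w"
    using tree_on_split[OF tree(2) xY(1) wY] by blast
  have cross2': "b = x \<and> a = w" if "a \<in> W" "b \<in> Z" "{a, b} \<in> E" for a b
    using cross2[of b a] that by (simp add: insert_commute)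
  have x'W: "x' \<in> W"
  proof (rule walk_stays[OF w(2) s(4)])
    fix y z assume y: "y \<in> W" and yz: "{y, z} \<in> E \<inter> Pow Y - {{x, w}}"
    then have "z \<in> Y" by auto
    moreover have "\<not> (z = x \<and> y = w)" using yz by (auto simp: insert_commute)
    ultimately show "z \<in> W" using cross2'[of y z] y yz s(1) by blast
  qed
  have "nonbridge x w"
  proof
    have "adj (E - {{x, w}}) x u" "adj (E - {{x, w}}) u x'"
      using ux uY wY(1) xY by (auto simp: adj_def doubleton_eq_iff insert_commute)
    moreover have "(adj (E - {{x, w}}))\<^sup>*\<^sup>* x' w"
      using adj_rtranclp_mono[OF adj_rtranclp_commute[OF w(2)], of "E - {{x, w}}"] by blast
    ultimately show "(adj (E - {{x, w}}))\<^sup>*\<^sup>* x w"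
      by (meson converse_rtranclp_into_rtranclp)
  qed (rule wY(2))
  then have wD: "w \<notin> D" using nb by blast
  have fin: "finite Z" "finite W" using finite_pieces(2) s(1) by (metis finite_Un)+
  have subZ: "subdividing E Z (D \<inter> Z)"
  proof (rule subdividing_restrict[OF subdividing_V])
    fix d z assume d: "d \<in> D \<inter> Z" "z \<in> V" "{d, z} \<in> E"
    have "z \<notin> X" using cross'[of d z] d s(1) xD by blast
    moreover have "z \<notin> W" using cross2[of d z] d xD by blast
    ultimately show "z \<in> Z" using d s(1) cover by blast
  qed (use pieces_subset s(1) in blast)+
  have subW: "subdividing E W (D \<inter> W)"
  proof (rule subdividing_restrict[OF subdividing_V])
    fix d z assume d: "d \<in> D \<inter> W" "z \<in> V" "{d, z} \<in> E"
    have "z \<notin> X" using cross'[of d z] d s(1) xD by blast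
    moreover have "z \<notin> Z" using cross2'[of d z] d wD by blast
    ultimately show "z \<in> W" using d s(1) cover by blast
  qed (use pieces_subset s(1) in blast)+
  have diff: "Z - D \<inter> Z = Z - D" "W - D \<inter> W = W - D" by blast+
  obtain p2 where p2: "card (Z - D) = Suc (p2 + card (D \<inter> Z))"
    "sigma Z E \<le> 2 ^ p2 * 3 ^ card (D \<inter> Z) + 2 ^ card (D \<inter> Z)"
    "sigma (Z - {x}) E \<le> 2 ^ p2 * 3 ^ card (D \<inter> Z)"
    using tree_star_bound[OF s(5) subZ, of x] s(3) xD diff by auto
  obtain p3 where p3: "card (W - D) = Suc (p3 + card (D \<inter> W))"
    "sigma W E \<le> 2 ^ p3 * 3 ^ card (D \<inter> W) + 2 ^ card (D \<inter> W)"
    "sigma (W - {w}) E \<le> 2 ^ p3 * 3 ^ card (D \<inter> W)"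
    using tree_star_bound[OF s(6) subW, of w] s(4) wD diff by auto
  \<comment> \<open>\<open>W\<close> is rooted twice, at \<open>w\<close> for
    \<open>sigma Y E\<close> and at \<open>x'\<close> for \<open>Y - {x, x'}\<close>. The parameter
    is determined by cardinalities, so both roots give the same star.\<close>
  obtain p3' where p3': "card (W - D) = Suc (p3' + card (D \<inter> W))"
    "sigma (W - {x'}) E \<le> 2 ^ p3' * 3 ^ card (D \<inter> W)"
    using tree_star_bound[OF s(6) subW, of x'] x'W xD diff by auto
  have "p3' = p3" using p3 p3' by simp
  have "2 \<le> card (Z - D)"
  proof -
    have "{x, u} \<in> E" "x \<in> V - D" "u \<noteq> w" using ux xY xD pieces_subset wY uY by (auto simp: insert_commute)
    then obtain n where n: "{x, n} \<in> E" "n \<noteq> u" "n \<noteq> w" "n \<noteq> x"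
      using third_neighbour[of x u w] wY(2) by metis
    have "n \<notin> X" using cross'[OF xY(1) _ n(1)] n(2) by blast
    moreover have "n \<notin> W" using cross2[OF s(3) _ n(1)] n(3) by blast
    ultimately have "n \<in> Z" using cover s(1) edge(3)[OF n(1)] by blast
    then show ?thesis
      using subdividing_card_ge_2[OF subZ fin(1), of x n] s(3) xD n(4) diff by auto
  qed
  have "2 \<le> card (W - D)"
  proof (cases "w = x'")
    case True
    have "{x', u} \<in> E" "{x', x} \<in> E" "x' \<in> V - D" "u \<noteq> x"
      using ux wY True xY xD pieces_subset uY by (auto simp: insert_commute)
    then obtain n where n: "{x', n} \<in> E" "n \<noteq> u" "n \<noteq> x" "n \<noteq> x'"
      using third_neighbour[of x' u x] by metis
    have "n \<notin> X" using cross'[OF xY(2) _ n(1)] n(2) by blast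
    moreover have "n \<notin> Z" using cross2'[OF x'W _ n(1)] n(3) by blast
    ultimately have "n \<in> W" using cover s(1) edge(3)[OF n(1)] by blast
    then show ?thesis
      using subdividing_card_ge_2[OF subW fin(2), of x' n] x'W xD n(4) diff by auto
  next
    case False
    then show ?thesis
      using subdividing_card_ge_2[OF subW fin(2), of x' w] x'W s(4) xD diff by auto
  qed
  obtain p1 where p1: "card (X - D) = Suc (p1 + card (D \<inter> X))" "1 \<le> p1 + card (D \<inter> X)"
    "sigma V E \<le> 2 ^ p1 * 3 ^ card (D \<inter> X) * sigma Y E + 2 ^ card (D \<inter> X) * sigma (Y - {x, x'}) E"
    by (rule bound_via_X)
  have "sigma Y E \<le> 2 ^ p2 * 3 ^ card (D \<inter> Z) * sigma W E
      + 2 ^ card (D \<inter> Z) * sigma (W - {z. {x, z} \<in> E}) E"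
    using sigma_cut_vertex_le[OF fin s(2,3) no_loop _ p2(2,3)] cross2 s(1) by metis
  also have "W - {z. {x, z} \<in> E} = W - {w}" using cross2[OF s(3)] wY(2) by blast
  also have "2 ^ p2 * 3 ^ card (D \<inter> Z) * sigma W E + 2 ^ card (D \<inter> Z) * sigma (W - {w}) E
      \<le> 2 ^ p2 * 3 ^ card (D \<inter> Z) * (2 ^ p3 * 3 ^ card (D \<inter> W) + 2 ^ card (D \<inter> W))
        + 2 ^ card (D \<inter> Z) * (2 ^ p3 * 3 ^ card (D \<inter> W))"
    using p3 by (intro add_mono mult_left_mono) auto
  finally have Y1: "sigma Y E \<le> \<dots>" .
  have "Y - {x, x'} = (Z - {x}) \<union> (W - {x'})" using s(1,2,3) x'W by blast
  moreover have "sigma ((Z - {x}) \<union> (W - {x'})) E = sigma (Z - {x}) E * sigma (W - {x'}) E"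
    by (rule sigma_union) (use fin s(2) cross2 in blast)+
  ultimately have Y2: "sigma (Y - {x, x'}) E \<le> 2 ^ p2 * 3 ^ card (D \<inter> Z) * (2 ^ p3 * 3 ^ card (D \<inter> W))"
    using mult_le_mono[OF p2(3) p3'(2)] \<open>p3' = p3\<close> by simp
  have "Y - D = (Z - D) \<union> (W - D)" "D \<inter> Y = (D \<inter> Z) \<union> (D \<inter> W)" using s(1) by blast+
  moreover have "card ((Z - D) \<union> (W - D)) = card (Z - D) + card (W - D)"
    "card ((D \<inter> Z) \<union> (D \<inter> W)) = card (D \<inter> Z) + card (D \<inter> W)"
    by (rule card_Un_disjoint; use fin s(2) in auto)+
  ultimately have c: "card (Y - D) = card (Z - D) + card (W - D)"
    "card (D \<inter> Y) = card (D \<inter> Z) + card (D \<inter> W)" by simp_all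
  note p1(3)
  also have "2 ^ p1 * 3 ^ card (D \<inter> X) * sigma Y E + 2 ^ card (D \<inter> X) * sigma (Y - {x, x'}) E
    \<le> 2 ^ p1 * 3 ^ card (D \<inter> X) * (2 ^ p2 * 3 ^ card (D \<inter> Z) * (2 ^ p3 * 3 ^ card (D \<inter> W) + 2 ^ card (D \<inter> W))
        + 2 ^ card (D \<inter> Z) * (2 ^ p3 * 3 ^ card (D \<inter> W)))
      + 2 ^ card (D \<inter> X) * (2 ^ p2 * 3 ^ card (D \<inter> Z) * (2 ^ p3 * 3 ^ card (D \<inter> W)))"
    by (intro add_mono mult_left_mono Y1 Y2) auto
  also have "\<dots> \<le> extremal (card (V - D)) (card D)"
    by (rule extremal_111)
      (use p1 p2(1) p3(1) \<open>2 \<le> card (Z - D)\<close> \<open>2 \<le> card (W - D)\<close> c card_split k in simp_all)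
  finally show ?thesis .
qed

end

context short_unicyclic
begin

theorem sigma_le_extremal: "sigma V E \<le> extremal (card (V - D)) (card D)"
proof -
  obtain u0 x0 where nb0: "nonbridge u0 x0" using unicyclic_nonbridge[OF uni] by metis
  \<comment> \<open>A subdivided cycle segment is preferred: if there is one, \<open>x\<close> is
    its midpoint and independence puts \<open>u\<close> outside \<open>D\<close>. Otherwise no cycle
    vertex lies in \<open>D\<close>, which settles \<open>x'\<close> as well.\<close>
  obtain u x where nb: "nonbridge u x" "u \<notin> D"
    and pref: "x \<in> D \<or> (\<forall>v d. d \<in> D \<longrightarrow> \<not> nonbridge v d)"
  proof (cases "\<exists>v d. d \<in> D \<and> nonbridge v d")
    case True
    then obtain v d where "d \<in> D" "nonbridge v d" by blast
    then show ?thesis using that[of v d] indep by (metis insert_commute)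
  next
    case False
    then show ?thesis using that[of u0 x0] nb0 nonbridge_commute[OF nb0] by blast
  qed
  obtain X Y x' where cut: "X \<union> Y = V" "X \<inter> Y = {}" "u \<in> X" "x \<in> Y" "x' \<in> Y" "x \<noteq> x'"
    "nonbridge u x'" "tree_on E X" "tree_on E Y"
    "\<And>a b. a \<in> X \<Longrightarrow> b \<in> Y \<Longrightarrow> {a, b} \<in> E \<Longrightarrow> a = u \<and> (b = x \<or> b = x')"
    using cycle_cut[OF nb(1)] by metis
  interpret cut_unicyclic V E D u x x' X Y
    by unfold_locales (use cut nb in blast)+
  consider "x \<in> D" "x' \<in> D" | "x \<in> D" "x' \<notin> D" | "x \<notin> D" "x' \<notin> D" "2 \<le> card D"
    | "\<forall>v d. d \<in> D \<longrightarrow> \<not> nonbridge v d" "card D \<le> 1"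
    using pref cut(7) by force
  then show ?thesis
  proof cases
    case 4
    then show ?thesis using bound_111 nb(1) cut(7) by blast
  qed (use bound_22 bound_21 bound_11 in blast)+
qed

end

subsection \<open>The extremal graphs\<close>

lemma sigma_no_edges:
  assumes "finite W" "\<And>u v. u \<in> W \<Longrightarrow> v \<in> W \<Longrightarrow> {u, v} \<notin> E"
  shows "sigma W E = 2 ^ card W"
proof -
  have "{S. S \<subseteq> W \<and> independent E S} = Pow W"
    using assms(2) unfolding independent_def by blast
  then show ?thesis using assms(1) by (simp add: sigma_def card_Pow)
qed

lemma sigma_UNION:
  assumes "finite I" "\<And>i. i \<in> I \<Longrightarrow> finite (P i)"
    and "\<And>i j u v. i \<in> I \<Longrightarrow> j \<in> I \<Longrightarrow> i \<noteq> j \<Longrightarrow> u \<in> P i \<Longrightarrow> v \<in> P j \<Longrightarrow> u \<noteq> v \<and> {u, v} \<notin> E"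
  shows "sigma (\<Union>i\<in>I. P i) E = (\<Prod>i\<in>I. sigma (P i) E)"
  using assms
proof (induction rule: finite_induct)
  case (insert i I)
  have "sigma (P i \<union> (\<Union>j\<in>I. P j)) E = sigma (P i) E * sigma (\<Union>j\<in>I. P j) E"
  proof (rule sigma_union)
    show "finite (P i)" "finite (\<Union>j\<in>I. P j)" using insert.hyps(1) insert.prems(1) by auto
    show "P i \<inter> (\<Union>j\<in>I. P j) = {}" using insert.prems(2)[of i] insert.hyps(2) by blast
    show "{x, y} \<notin> E" if "x \<in> P i" "y \<in> (\<Union>j\<in>I. P j)" for x y
      using that insert.prems(2)[of i] insert.hyps(2) by blast
  qed
  moreover have "sigma (\<Union>j\<in>I. P j) E = (\<Prod>j\<in>I. sigma (P j) E)"
    using insert.IH insert.prems by blast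
  ultimately show ?case using insert.hyps by simp
qed simp

section \<open>Counts for cycles with two branch vertices\<close>

lemma U_E_adjacency:
  "{PX i j, PX i' j'} \<in> U_E a b s r \<longleftrightarrow> i' = i \<and> i < length s \<and>
     ((1 \<le> j \<and> j < s ! i \<and> j' = j + 1) \<or> (1 \<le> j' \<and> j' < s ! i \<and> j = j' + 1))"
  "{PY i j, PY i' j'} \<in> U_E a b s r \<longleftrightarrow> i' = i \<and> i < length r \<and>
     ((1 \<le> j \<and> j < r ! i \<and> j' = j + 1) \<or> (1 \<le> j' \<and> j' < r ! i \<and> j = j' + 1))"
  "{PX i j, PY i' j'} \<notin> U_E a b s r" "{PY i' j', PX i j} \<notin> U_E a b s r"
  "{Cyc k, PX i j} \<in> U_E a b s r \<longleftrightarrow> k = 0 \<and> j = 1 \<and> i < length s \<and> 1 \<le> s ! i"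
  "{PX i j, Cyc k} \<in> U_E a b s r \<longleftrightarrow> k = 0 \<and> j = 1 \<and> i < length s \<and> 1 \<le> s ! i"
  "{Cyc k, PY i j} \<in> U_E a b s r \<longleftrightarrow> k = a \<and> j = 1 \<and> i < length r \<and> 1 \<le> r ! i"
  "{PY i j, Cyc k} \<in> U_E a b s r \<longleftrightarrow> k = a \<and> j = 1 \<and> i < length r \<and> 1 \<le> r ! i"
  "{Cyc k, Cyc l} \<in> U_E a b s r \<longleftrightarrow>
     (k < a + b \<and> l = (k + 1) mod (a + b)) \<or> (l < a + b \<and> k = (l + 1) mod (a + b))"
  unfolding U_E_def by (auto simp: doubleton_eq_iff)

text \<open>Paths with zero, one and two vertices have one, two and three independent sets, so at
  these lengths the Fibonacci numbers are linear in the length.\<close>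

lemma sigma_short_path_PX:
  assumes "i < length s" "s ! i \<in> {1, 2}"
  shows "sigma {PX i j | j. 1 \<le> j \<and> j \<le> s ! i} (U_E a b s r) = s ! i + 1"
    and "sigma ({PX i j | j. 1 \<le> j \<and> j \<le> s ! i} - {PX i 1}) (U_E a b s r) = s ! i"
proof -
  let ?E = "U_E a b s r"
  have one: "{PX i j} \<notin> ?E" for j using U_E_adjacency(1)[of i j i j] by simp
  have "sigma {PX i j | j. 1 \<le> j \<and> j \<le> s ! i} ?E = s ! i + 1 \<and>
    sigma ({PX i j | j. 1 \<le> j \<and> j \<le> s ! i} - {PX i 1}) ?E = s ! i"
  proof (cases "s ! i = 1")
    case True
    then have "{PX i j | j. 1 \<le> j \<and> j \<le> s ! i} = {PX i 1}" by auto
    then show ?thesis using True sigma_singleton[OF one] by simp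
  next
    case False
    then have s: "s ! i = 2" using assms by auto
    then have eq: "{PX i j | j. 1 \<le> j \<and> j \<le> s ! i} = {PX i 1, PX i 2}" by auto
    have "sigma {PX i 1, PX i 2} ?E = sigma ({PX i 1, PX i 2} - {PX i 1}) ?E
        + sigma ({PX i 1, PX i 2} - {PX i 1} - {w. {PX i 1, w} \<in> ?E}) ?E"
      by (rule sigma_delete) (use one in auto)
    moreover have "{PX i 1, PX i 2} - {PX i 1} = {PX i 2}" by auto
    moreover have "{PX i 2} - {w. {PX i 1, w} \<in> ?E} = {}"
      using U_E_adjacency(1)[of i 1 i 2] assms s by auto
    ultimately show ?thesis using s eq sigma_singleton[OF one] by simp
  qed
  then show "sigma {PX i j | j. 1 \<le> j \<and> j \<le> s ! i} ?E = s ! i + 1"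
    "sigma ({PX i j | j. 1 \<le> j \<and> j \<le> s ! i} - {PX i 1}) ?E = s ! i" by auto
qed

lemma sigma_short_path_PY:
  assumes "i < length r" "r ! i \<in> {1, 2}"
  shows "sigma {PY i j | j. 1 \<le> j \<and> j \<le> r ! i} (U_E a b s r) = r ! i + 1"
    and "sigma ({PY i j | j. 1 \<le> j \<and> j \<le> r ! i} - {PY i 1}) (U_E a b s r) = r ! i"
proof -
  let ?E = "U_E a b s r"
  have one: "{PY i j} \<notin> ?E" for j using U_E_adjacency(2)[of i j i j] by simp
  have "sigma {PY i j | j. 1 \<le> j \<and> j \<le> r ! i} ?E = r ! i + 1 \<and>
    sigma ({PY i j | j. 1 \<le> j \<and> j \<le> r ! i} - {PY i 1}) ?E = r ! i"
  proof (cases "r ! i = 1")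
    case True
    then have "{PY i j | j. 1 \<le> j \<and> j \<le> r ! i} = {PY i 1}" by auto
    then show ?thesis using True sigma_singleton[OF one] by simp
  next
    case False
    then have r: "r ! i = 2" using assms by auto
    then have eq: "{PY i j | j. 1 \<le> j \<and> j \<le> r ! i} = {PY i 1, PY i 2}" by auto
    have "sigma {PY i 1, PY i 2} ?E = sigma ({PY i 1, PY i 2} - {PY i 1}) ?E
        + sigma ({PY i 1, PY i 2} - {PY i 1} - {w. {PY i 1, w} \<in> ?E}) ?E"
      by (rule sigma_delete) (use one in auto)
    moreover have "{PY i 1, PY i 2} - {PY i 1} = {PY i 2}" by auto
    moreover have "{PY i 2} - {w. {PY i 1, w} \<in> ?E} = {}"
      using U_E_adjacency(2)[of i 1 i 2] assms r by auto
    ultimately show ?thesis using r eq sigma_singleton[OF one] by simp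
  qed
  then show "sigma {PY i j | j. 1 \<le> j \<and> j \<le> r ! i} ?E = r ! i + 1"
    "sigma ({PY i j | j. 1 \<le> j \<and> j \<le> r ! i} - {PY i 1}) ?E = r ! i" by auto
qed

text \<open>The four terms correspond to choosing neither branch vertex, only \<open>Cyc 2\<close>,
  only \<open>Cyc 0\<close>, or both. The other \<open>b\<close> cycle vertices are free only in the
  first case; for \<open>b = 1\<close> the branch vertices are adjacent and the last case
  disappears.\<close>

lemma sigma_U:
  assumes s: "set s \<subseteq> {1, 2}" and r: "r \<in> {1, 2}" and b: "b = 1 \<or> b = 2"
  shows "sigma (U_V 2 b s [r]) (U_E 2 b s [r]) =
    2 ^ b * prod_list (map Suc s) * (r + 1) + prod_list (map Suc s) * r
      + prod_list s * (r + 1) + (if b = 2 then prod_list s * r else 0)"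
proof -
  define E where "E = U_E 2 b s [r]"
  define PP where "PP i = {PX i j | j. 1 \<le> j \<and> j \<le> s ! i}" for i
  define P where "P = (\<Union>i<length s. PP i)"
  define P' where "P' = (\<Union>i<length s. PP i - {PX i 1})"
  define Q where "Q = {PY 0 j | j. 1 \<le> j \<and> j \<le> r}"
  define C where "C = (if b = 2 then {Cyc 1, Cyc 3} else {Cyc 1})"
  have V: "U_V 2 b s [r] = insert (Cyc 0) (insert (Cyc 2) (C \<union> P \<union> Q))"
  proof -
    have "Cyc ` {..<2 + b} = insert (Cyc 0) (insert (Cyc 2) C)"
      using b by (auto simp: C_def numeral_eq_Suc lessThan_Suc)
    moreover have "{PX i j | i j. i < length s \<and> 1 \<le> j \<and> j \<le> s ! i} = P" by (auto simp: P_def PP_def)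
    moreover have "{PY i j | i j. i < length [r] \<and> 1 \<le> j \<and> j \<le> [r] ! i} = Q" by (auto simp: Q_def)
    ultimately show ?thesis unfolding U_V_def by auto
  qed
  have s_nth: "s ! i \<in> {1, 2}" if "i < length s" for i using s that nth_mem by blast
  have finPP: "finite (PP i)" for i
  proof -
    have "PP i \<subseteq> PX i ` {..s ! i}" by (auto simp: PP_def)
    then show ?thesis by (rule finite_subset) simp
  qed
  have "Q \<subseteq> PY 0 ` {..r}" by (auto simp: Q_def)
  then have finQ: "finite Q" by (rule finite_subset) simp
  have fin: "finite P" "finite P'" "finite C" using finPP by (auto simp: P_def P'_def C_def)
  have "sigma P E = (\<Prod>i<length s. sigma (PP i) E)"
    unfolding P_def by (rule sigma_UNION) (use finPP in \<open>auto simp: PP_def E_def U_E_adjacency\<close>)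
  also have "\<dots> = (\<Prod>i<length s. s ! i + 1)"
    by (rule prod.cong) (use sigma_short_path_PX(1) s_nth in \<open>auto simp: PP_def E_def\<close>)
  also have "\<dots> = prod_list (map Suc s)"
    by (simp add: prod.list_conv_set_nth atLeast0LessThan)
  finally have sP: "sigma P E = prod_list (map Suc s)" .
  have "sigma P' E = (\<Prod>i<length s. sigma (PP i - {PX i 1}) E)"
    unfolding P'_def by (rule sigma_UNION) (use finPP in \<open>auto simp: PP_def E_def U_E_adjacency\<close>)
  also have "\<dots> = (\<Prod>i<length s. s ! i)"
    by (rule prod.cong) (use sigma_short_path_PX(2) s_nth in \<open>auto simp: PP_def E_def\<close>)
  also have "\<dots> = prod_list s"
    by (simp add: prod.list_conv_set_nth atLeast0LessThan)
  finally have sP': "sigma P' E = prod_list s" .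
  have sQ: "sigma Q E = r + 1" "sigma (Q - {PY 0 1}) E = r"
    using sigma_short_path_PY[of 0 "[r]"] r by (simp_all add: Q_def E_def)
  have loop: "{Cyc k} \<notin> E" for k
    using U_E_adjacency(9)[of k k 2 b s "[r]"] b by (auto simp: E_def mod_Suc split: if_splits)
  have CC: "{Cyc 1, Cyc 3} \<notin> E" "{Cyc 3, Cyc 1} \<notin> E" if "b = 2"
    using that by (auto simp: E_def U_E_adjacency mod_Suc)
  have "sigma C E = 2 ^ card C"
    by (rule sigma_no_edges) (use fin CC loop in \<open>auto simp: C_def split: if_splits\<close>)
  also have "card C = b" using b by (auto simp: C_def)
  finally have sC: "sigma C E = 2 ^ b" .
  have pq: "sigma (A \<union> B) E = sigma A E * sigma B E" if "A \<subseteq> P" "B \<subseteq> Q" for A B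
  proof (rule sigma_union)
    show "finite A" "finite B" using that fin finQ finite_subset by auto
    have "P \<inter> Q = {}" by (auto simp: P_def PP_def Q_def)
    then show "A \<inter> B = {}" using that by blast
    fix x y assume "x \<in> A" "y \<in> B"
    then have "x \<in> P" "y \<in> Q" using that by blast+
    then show "{x, y} \<notin> E" by (auto simp: P_def PP_def Q_def E_def U_E_adjacency)
  qed
  have sCPQ: "sigma (C \<union> (P \<union> Q)) E = sigma C E * sigma (P \<union> Q) E"
    by (rule sigma_union)
      (use fin finQ in \<open>auto simp: P_def PP_def Q_def C_def E_def U_E_adjacency split: if_splits\<close>)
  have P'P: "P' \<subseteq> P" by (auto simp: P_def P'_def)
  let ?V = "U_V 2 b s [r]" and ?N = "\<lambda>v. {w. {v, w} \<in> E}"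
  have finV: "finite ?V" unfolding V using fin finQ by simp
  have Vx: "?V - {Cyc 0} = insert (Cyc 2) (C \<union> (P \<union> Q))"
    unfolding V by (auto simp: P_def PP_def Q_def C_def)
  have Vxy: "?V - {Cyc 0} - {Cyc 2} = C \<union> (P \<union> Q)"
    unfolding V by (auto simp: P_def PP_def Q_def C_def)
  have Vxy': "?V - {Cyc 0} - {Cyc 2} - ?N (Cyc 2) = P \<union> (Q - {PY 0 1})"
    unfolding Vxy using b r
    by (auto simp: P_def PP_def Q_def C_def E_def U_E_adjacency mod_Suc split: if_splits)
  have "sigma (?V - {Cyc 0}) E = sigma (C \<union> (P \<union> Q)) E + sigma (P \<union> (Q - {PY 0 1})) E"
    using sigma_delete[of "?V - {Cyc 0}" "Cyc 2" E] fin finQ loop Vx Vxy Vxy' by simp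
  moreover have "sigma (?V - {Cyc 0} - ?N (Cyc 0)) E = prod_list s * (r + 1) + (if b = 2 then prod_list s * r else 0)"
  proof (cases "b = 2")
    case True
    have V0: "?V - {Cyc 0} - ?N (Cyc 0) = insert (Cyc 2) (P' \<union> Q)"
      unfolding Vx using True s_nth
      by (auto simp: P_def P'_def PP_def Q_def C_def E_def U_E_adjacency mod_Suc)
    have "insert (Cyc 2) (P' \<union> Q) - {Cyc 2} = P' \<union> Q"
      by (auto simp: P'_def PP_def Q_def)
    moreover have "insert (Cyc 2) (P' \<union> Q) - {Cyc 2} - ?N (Cyc 2) = P' \<union> (Q - {PY 0 1})"
      using r by (auto simp: P'_def PP_def Q_def E_def U_E_adjacency)
    ultimately show ?thesis
      unfolding V0 using sigma_delete[of "insert (Cyc 2) (P' \<union> Q)" "Cyc 2" E] fin finQ loop True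
        pq[OF P'P, of Q] pq[OF P'P, of "Q - {PY 0 1}"] sP' sQ by simp
  next
    case False
    have "?V - {Cyc 0} - ?N (Cyc 0) = P' \<union> Q"
      unfolding Vx using False b s_nth
      by (auto simp: P_def P'_def PP_def Q_def C_def E_def U_E_adjacency mod_Suc)
    then show ?thesis using pq[OF P'P, of Q] sP' sQ False by simp
  qed
  moreover have "sigma ?V E = sigma (?V - {Cyc 0}) E + sigma (?V - {Cyc 0} - ?N (Cyc 0)) E"
    by (rule sigma_delete) (use finV loop V in auto)
  ultimately show ?thesis
    unfolding E_def[symmetric]
    using sCPQ pq[of P Q] pq[of P "Q - {PY 0 1}"] sC sP sQ by (simp add: algebra_simps)
qed

text \<open>Without the hub 2 there remain the path 3, 0, 1, 4 with eight independent sets and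
  \<open>m - 5\<close> isolated leaves; if the hub is chosen, only 3 and 4 are free.\<close>

lemma sigma_U1:
  assumes "6 \<le> m"
  shows "sigma (U1_V m) (U1_E m) = 2 ^ (m - 2) + 4"
proof -
  define E where "E = U1_E m"
  have adj: "{u, v} \<in> E \<longleftrightarrow> {u, v} \<in> {{0, 1}, {1, 2}, {0, 2}, {0, 3}, {1, 4}} \<or>
      (u = 2 \<and> 5 \<le> v \<and> v < m) \<or> (v = 2 \<and> 5 \<le> u \<and> u < m)" for u v
    unfolding E_def U1_E_def by (auto simp: doubleton_eq_iff)
  note simps = adj doubleton_eq_iff
  have loop: "{v} \<notin> E" for v using adj[of v v] by (auto simp: doubleton_eq_iff)
  have two: "sigma {v} E = 2" for v by (rule sigma_singleton[OF loop])
  have "sigma {3, 4} E = 2 ^ card {3, 4 :: nat}"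
    by (rule sigma_no_edges) (auto simp: simps)
  then have s34: "sigma {3, 4} E = 4" by simp
  have "sigma {1, 3, 4} E = sigma ({1, 3, 4} - {1}) E + sigma ({1, 3, 4} - {1} - {w. {1, w} \<in> E}) E"
    by (rule sigma_delete) (use loop in auto)
  moreover have "{1, 3, 4} - {1} = {3, 4::nat}" "{3, 4} - {w. {1, w} \<in> E} = {3}" by (auto simp: simps)
  ultimately have s134: "sigma {1, 3, 4} E = 6" using s34 two by simp
  have "sigma {0, 1, 3, 4} E = sigma ({0, 1, 3, 4} - {0}) E + sigma ({0, 1, 3, 4} - {0} - {w. {0, w} \<in> E}) E"
    by (rule sigma_delete) (use loop in auto)
  moreover have "{0, 1, 3, 4} - {0} = {1, 3, 4::nat}" "{1, 3, 4} - {w. {0, w} \<in> E} = {4}" by (auto simp: simps)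
  ultimately have s0134: "sigma {0, 1, 3, 4} E = 8" using s134 two by simp
  have "sigma {5..<m} E = 2 ^ card {5..<m}"
    by (rule sigma_no_edges) (auto simp: simps)
  then have leaves: "sigma {5..<m} E = 2 ^ (m - 5)" by simp
  have "sigma ({0, 1, 3, 4} \<union> {5..<m}) E = 8 * 2 ^ (m - 5)"
    unfolding s0134[symmetric] leaves[symmetric]
    by (rule sigma_union) (auto simp: simps)
  moreover have V2: "U1_V m - {2} = {0, 1, 3, 4} \<union> {5..<m}"
    using assms by (auto simp: U1_V_def)
  moreover have "U1_V m - {2} - {w. {2, w} \<in> E} = {3, 4}"
    unfolding V2 by (auto simp: simps)
  moreover have "sigma (U1_V m) E = sigma (U1_V m - {2}) E + sigma (U1_V m - {2} - {w. {2, w} \<in> E}) E"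
    by (rule sigma_delete) (use loop assms in \<open>auto simp: U1_V_def\<close>)
  moreover have "(2::nat) ^ (m - 2) = 8 * 2 ^ (m - 5)"
  proof -
    have "m - 2 = 3 + (m - 5)" using assms by simp
    then show ?thesis by (simp only: power_add) simp
  qed
  ultimately show ?thesis using s34 by (simp add: E_def)
qed

text \<open>The branches of \<open>extremal\<close> for positive \<open>k\<close> are the values of
  \<open>sigma_U\<close>, separated by how many of the first three segment lengths equal
  two.\<close>

lemma sigma_U_extremal:
  assumes "ls = replicate k 2 @ replicate (m - k) 1" "k \<le> m" "1 \<le> k" "4 \<le> m"
  shows "sigma (U_V 2 (ls ! 1) (drop 3 ls) [ls ! 2]) (U_E 2 (ls ! 1) (drop 3 ls) [ls ! 2]) = extremal m k"
proof -
  \<comment> \<open>Subtraction is truncated: for \<open>k < 3\<close> the dropped prefix contains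
    all twos and \<open>3 - k\<close> ones, otherwise no ones.\<close>
  have drop: "drop 3 ls = replicate (k - 3) 2 @ replicate (m - k - (3 - k)) 1"
    using assms(1) by simp
  have nth: "ls ! i = (if i < k then 2 else 1)" if "i < m" for i
    using that assms(1,2) by (auto simp: nth_append)
  have prods: "prod_list (map Suc (drop 3 ls)) = 3 ^ (k - 3) * 2 ^ (m - k - (3 - k))"
    "prod_list (drop 3 ls) = 2 ^ (k - 3)"
    unfolding drop by (simp_all flip: numeral_2_eq_2 numeral_3_eq_3)
  have U: "sigma (U_V 2 (ls ! 1) (drop 3 ls) [ls ! 2]) (U_E 2 (ls ! 1) (drop 3 ls) [ls ! 2]) =
    2 ^ (ls ! 1) * (3 ^ (k - 3) * 2 ^ (m - k - (3 - k))) * (ls ! 2 + 1)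
      + 3 ^ (k - 3) * 2 ^ (m - k - (3 - k)) * ls ! 2
      + 2 ^ (k - 3) * (ls ! 2 + 1) + (if ls ! 1 = 2 then 2 ^ (k - 3) * ls ! 2 else 0)"
    unfolding prods[symmetric]
    by (rule sigma_U) (use assms(4) nth[of 1] nth[of 2] in \<open>auto simp: drop split: if_splits\<close>)
  consider "k = 1" | "k = 2" | "3 \<le> k" using assms(3) by linarith
  then show ?thesis
  proof cases
    case 3
    then show ?thesis unfolding U using assms nth[of 1] nth[of 2] by (simp add: extremal_def)
  qed (unfold U, use assms nth[of 1] nth[of 2] in \<open>simp_all add: extremal_def\<close>)
qed

theorem theorem7:
  fixes V :: "'a set" and E :: "'a set set" and ls :: "nat list"
  assumes "unicyclic V E"
    and "segment_sequence V E = ls"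
    and "ls \<noteq> []" and "ls ! 0 \<le> 2"
  shows "(ls ! 0 = 2 \<and> length ls \<ge> 4 \<longrightarrow>
           sigma V E \<le> sigma (U_V (ls ! 0) (ls ! 1) (drop 3 ls) [ls ! 2])
                              (U_E (ls ! 0) (ls ! 1) (drop 3 ls) [ls ! 2]))
       \<and> (ls ! 0 = 1 \<and> length ls \<ge> 6 \<longrightarrow>
           sigma V E \<le> sigma (U1_V (length ls)) (U1_E (length ls)))"
proof -
  define D where "D = {v \<in> V. degree E v = 2}"
  define m where "m = card (V - D)"
  define k where "k = card D"
  note short = unicyclic_short_segments[OF assms, folded D_def]
  have ls: "ls = replicate k 2 @ replicate (m - k) 1" and km: "k \<le> m"
    using short(2,3) by (simp_all add: m_def k_def)
  interpret short_unicyclic V E D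
    by unfold_locales (use assms(1) short(1) in \<open>auto simp: D_def adj_def\<close>)
  have bound: "sigma V E \<le> extremal m k"
    using sigma_le_extremal by (simp add: m_def k_def)
  have len: "length ls = m" using ls km by simp
  have k0: "k = 0" if "ls ! 0 = 1"
    using that ls by (cases k) auto
  have k1: "1 \<le> k" if "ls ! 0 = 2" "4 \<le> m"
    using that ls by (cases k) auto
  show ?thesis
  proof (intro conjI impI)
    assume "ls ! 0 = 2 \<and> 4 \<le> length ls"
    then show "sigma V E \<le> sigma (U_V (ls ! 0) (ls ! 1) (drop 3 ls) [ls ! 2])
        (U_E (ls ! 0) (ls ! 1) (drop 3 ls) [ls ! 2])"
      using bound sigma_U_extremal[OF ls km] k1 len by simp
  next
    assume "ls ! 0 = 1 \<and> 6 \<le> length ls"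
    then show "sigma V E \<le> sigma (U1_V (length ls)) (U1_E (length ls))"
      using bound sigma_U1[of m] k0 len by (simp add: extremal_def)
  qed
qed

end
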